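(* Let $n\ge1$ be an integer and, for each real $s>0$, let $\omega_s$ be the Kähler metric on the $n$-th Hirzebruch surface $\mathbb{F}_n$ given in the coordinates $(z_1,z_2)$ by $$\omega_s=\frac{\sqrt{-1}}{2}\,\partial\bar\partial\Big(\log(1+z_1\bar z_1)+s\log\big((1+z_1\bar z_1)^n+z_2\bar z_2\big)\Big).$$ Then $\frac{1}{(1+2n)^2}$ is the optimal pinching constant for the holomorphic sectional curvature in the family $(\omega_s)_{s>0}$: if $s>0$ is such that the holomorphic sectional curvature of $\omega_s$ is positive and $c$-pinched, then $c\le\frac{1}{(1+2n)^2}$; and for $s=\frac{1}{2n^2+n}$ the holomorphic sectional curvature of $\omega_s$ is positive and $\frac{1}{(1+2n)^2}$-pinched.
   Context: The $n$-th Hirzebruch surface is $\mathbb{F}_n=\mathbb{P}(\mathcal{O}_{\mathbb{P}^1}(n)\oplus\mathcal{O}_{\mathbb{P}^1})$, a $\mathbb{P}^1$-bundle over $\mathbb{P}^1$. Concretely, $z_1$ is an inhomogeneous coordinate on the base $\mathbb{P}^1$ and $z_2$ an inhomogeneous coordinate on the fibers, and $\mathbb{F}_n$ is obtained by gluing two copies of $\mathbb{C}\times\mathbb{P}^1$, with coordinates $(z_1,z_2)$ and $(z_1',z_2')$, via $z_1'=1/z_1$, $z_2'=z_2/z_1^n$ over $z_1\ne0$. The form $\omega_s$ extends to a globally well-defined Kähler metric on $\mathbb{F}_n$. Let $M$ be an $m$-dimensional complex manifold with local holomorphic coordinates $z_1,\dots,z_m$. A Hermitian metric $g=\sum_{i,j=1}^m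 g_{i\bar j}\,dz_i\otimes d\bar z_j$ is identified with its associated $(1,1)$-form $\omega=\frac{\sqrt{-1}}{2}\sum_{i,j=1}^m g_{i\bar j}\,dz_i\wedge d\bar z_j$. The curvature components are $$R_{i\bar jk\bar l}=-\frac{\partial^2 g_{i\bar j}}{\partial z_k\partial\bar z_l}+\sum_{p,q=1}^m g^{p\bar q}\frac{\partial g_{i\bar p}}{\partial z_k}\frac{\partial g_{q\bar j}}{\partial\bar z_l},$$ where $(g^{p\bar q})$ is the inverse matrix of $(g_{i\bar j})$. For a non-zero tangent vector $\xi=\sum_i\xi_i\frac{\partial}{\partial z_i}$ at a point $p\in M$, the holomorphic sectional curvature is $$K(\xi)=\Big(2\sum_{i,j,k,l=1}^m R_{i\bar jk\bar l}(p)\,\xi_i\bar\xi_j\xi_k\bar\xi_l\Big)\Big/\Big(\sum_{i,j,k,l=1}^m g_{i\bar j}(p)g_{k\bar l}(p)\,\xi_i\bar\xi_j\xi_k\bar\xi_l\Big).$$ For a constant $c\in(0,1]$, positive holomorphic sectional curvature is called $c$-pinched if $\frac{\inf_\xi K(\xi)}{\sup_\xi K(\xi)}=c$ (equality), where the infimum and supremum are over all non-zero tangent vectors at all points of the manifold. *)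

theory Defs
  imports "HOL-Analysis.Analysis"
begin

section \<open>Wirtinger derivatives\<close>

definition partial_re :: "'m::finite \<Rightarrow> (complex^'m \<Rightarrow> complex) \<Rightarrow> complex^'m \<Rightarrow> complex" where
  "partial_re k f z = vector_derivative (\<lambda>t::real. f (z + axis k (of_real t))) (at 0)"

definition partial_im :: "'m::finite \<Rightarrow> (complex^'m \<Rightarrow> complex) \<Rightarrow> complex^'m \<Rightarrow> complex" where
  "partial_im k f z = vector_derivative (\<lambda>t::real. f (z + axis k (\<i> * of_real t))) (at 0)"

definition wirtinger :: "'m::finite \<Rightarrow> (complex^'m \<Rightarrow> complex) \<Rightarrow> complex^'m \<Rightarrow> complex" where
  "wirtinger k f z = (partial_re k f z - \<i> * partial_im k f z) / 2"

definition wirtinger_bar :: "'m::finite \<Rightarrow> (complex^'m \<Rightarrow> complex) \<Rightarrow> complex^'m \<Rightarrow> complex" where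
  "wirtinger_bar k f z = (partial_re k f z + \<i> * partial_im k f z) / 2"


section \<open>Curvature of a Hermitian metric in a coordinate chart\<close>

text \<open>
  A Hermitian metric in a chart is the matrix-valued function \<open>z \<mapsto> (g z $ i $ j)\<close>, the entry
  being the coefficient of \<open>dz\<^sub>i \<otimes> d\<close>(conjugate of \<open>z\<^sub>j\<close>).  The associated form is
  \<open>\<i>/2\<close> times the sum of \<open>g z $ i $ j dz\<^sub>i \<and> d\<close>(conjugate of \<open>z\<^sub>j\<close>).  Thus the metric with
  \<open>\<omega> = \<i>/2 \<partial>\<close>(\<open>\<partial>\<close>-bar)\<open>\<phi>\<close> is the complex Hessian of \<open>\<phi>\<close>.
\<close>

type_synonym 'm chart_metric = "complex^'m \<Rightarrow> complex^'m^'m"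

definition complex_hessian :: "(complex^'m::finite \<Rightarrow> real) \<Rightarrow> 'm chart_metric" where
  "complex_hessian \<phi> z =
     (\<chi> i j. wirtinger i (wirtinger_bar j (\<lambda>w. complex_of_real (\<phi> w))) z)"

definition curvature ::
  "'m::finite chart_metric \<Rightarrow> complex^'m \<Rightarrow> 'm \<Rightarrow> 'm \<Rightarrow> 'm \<Rightarrow> 'm \<Rightarrow> complex" where
  "curvature g z i j k l =
     - wirtinger k (wirtinger_bar l (\<lambda>w. g w $ i $ j)) z
     + (\<Sum>p\<in>UNIV. \<Sum>q\<in>UNIV. matrix_inv (g z) $ p $ q
          * wirtinger k (\<lambda>w. g w $ i $ p) z * wirtinger_bar l (\<lambda>w. g w $ q $ j) z)"

text \<open>Numerator and denominator are real for a Hermitian metric; \<open>Re\<close> only changes the type.\<close>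

definition hol_sect_curv :: "'m::finite chart_metric \<Rightarrow> complex^'m \<Rightarrow> complex^'m \<Rightarrow> real" where
  "hol_sect_curv g z \<xi> =
     Re ((2 * (\<Sum>i\<in>UNIV. \<Sum>j\<in>UNIV. \<Sum>k\<in>UNIV. \<Sum>l\<in>UNIV.
                 curvature g z i j k l * \<xi> $ i * cnj (\<xi> $ j) * \<xi> $ k * cnj (\<xi> $ l)))
         / (\<Sum>i\<in>UNIV. \<Sum>j\<in>UNIV. \<Sum>k\<in>UNIV. \<Sum>l\<in>UNIV.
                 g z $ i $ j * g z $ k $ l * \<xi> $ i * cnj (\<xi> $ j) * \<xi> $ k * cnj (\<xi> $ l)))"


section \<open>Pinching on a manifold glued from charts\<close>

text \<open>
  A point of a manifold glued from copies of \<open>\<complex>\<^sup>m\<close> indexed by \<open>'c\<close> is the set of all its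
  representatives (chart, coordinates).  A metric is given by its coefficients in every chart,
  and a tangent vector at a point by its components in any chart around that point.
\<close>

type_synonym ('c, 'm) glued_point = "('c \<times> (complex^'m)) set"

definition hsc_values ::
  "('c, 'm::finite) glued_point set \<Rightarrow> ('c \<Rightarrow> 'm chart_metric) \<Rightarrow> real set" where
  "hsc_values M g = {hol_sect_curv (g c) z \<xi> | P c z \<xi>. P \<in> M \<and> (c, z) \<in> P \<and> \<xi> \<noteq> 0}"

definition positive_hsc ::
  "('c, 'm::finite) glued_point set \<Rightarrow> ('c \<Rightarrow> 'm chart_metric) \<Rightarrow> bool" where
  "positive_hsc M g \<longleftrightarrow> (\<forall>K\<in>hsc_values M g. 0 < K)"

text \<open>
  The boundedness conditions make \<open>Inf\<close> and \<open>Sup\<close> the true infimum and supremum; they exclude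
  nothing, as an infinite supremum is incompatible with a positive quotient.
\<close>

definition pinched_hsc ::
  "('c, 'm::finite) glued_point set \<Rightarrow> ('c \<Rightarrow> 'm chart_metric) \<Rightarrow> real \<Rightarrow> bool" where
  "pinched_hsc M g c \<longleftrightarrow> 0 < c \<and> c \<le> 1
     \<and> bdd_below (hsc_values M g) \<and> bdd_above (hsc_values M g)
     \<and> Inf (hsc_values M g) / Sup (hsc_values M g) = c"


section \<open>The Hirzebruch surfaces\<close>

text \<open>
  Each of the two copies of \<open>\<complex> \<times> \<complex>\<P>\<^sup>1\<close> (base charts \<open>Base0\<close> and \<open>BaseInf\<close>) is covered by two
  copies of \<open>\<complex>\<^sup>2\<close>: in \<open>Fib0\<close> the second coordinate is the inhomogeneous fibre coordinate \<open>z\<^sub>2\<close>,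
  in \<open>FibInf\<close> it is \<open>1 / z\<^sub>2\<close>.  The glueing \<open>z\<^sub>1' = 1 / z\<^sub>1\<close>, \<open>z\<^sub>2' = z\<^sub>2 / z\<^sub>1 ^ n\<close> therefore reads
  \<open>1 / z\<^sub>2' = z\<^sub>1 ^ n * (1 / z\<^sub>2)\<close> in the \<open>FibInf\<close> charts, and it is an involution.
\<close>

datatype base_chart = Base0 | BaseInf
datatype fibre_chart = Fib0 | FibInf

type_synonym hchart = "base_chart \<times> fibre_chart"

fun base_change :: "nat \<Rightarrow> fibre_chart \<Rightarrow> complex^2 \<Rightarrow> complex^2" where
  "base_change n Fib0 z = vector [1 / z$1, z$2 / z$1 ^ n]"
| "base_change n FibInf z = vector [1 / z$1, z$1 ^ n * z$2]"

definition fibre_change :: "complex^2 \<Rightarrow> complex^2" where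
  "fibre_change z = vector [z$1, 1 / z$2]"

fun overlap :: "hchart \<Rightarrow> hchart \<Rightarrow> (complex^2) set" where
  "overlap (a, b) (a', b') = {z. (a \<noteq> a' \<longrightarrow> z$1 \<noteq> 0) \<and> (b \<noteq> b' \<longrightarrow> z$2 \<noteq> 0)}"

fun transition :: "nat \<Rightarrow> hchart \<Rightarrow> hchart \<Rightarrow> complex^2 \<Rightarrow> complex^2" where
  "transition n (a, b) (a', b') z =
     (let w = (if a = a' then z else base_change n b z)
      in if b = b' then w else fibre_change w)"

definition hirzebruch_rel :: "nat \<Rightarrow> ((hchart \<times> (complex^2)) \<times> (hchart \<times> (complex^2))) set" where
  "hirzebruch_rel n = {((c, z), (c', z')). z \<in> overlap c c' \<and> z' = transition n c c' z}"

definition hirzebruch :: "nat \<Rightarrow> (hchart, 2) glued_point set" where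
  "hirzebruch n = UNIV // hirzebruch_rel n"

lemma vec2_eq_iff: "(x :: complex^2) = y \<longleftrightarrow> x$1 = y$1 \<and> x$2 = y$2"
  by (simp add: vec_eq_iff forall_2)

lemma equiv_hirzebruch_rel: "equiv UNIV (hirzebruch_rel n)"
proof (rule equivI)
  show "hirzebruch_rel n \<subseteq> UNIV \<times> UNIV" by simp
  show "refl (hirzebruch_rel n)"
    by (auto simp: refl_on_def hirzebruch_rel_def)
  show "sym (hirzebruch_rel n)"
  proof (rule symI, clarify)
    fix a b z a' b' z'
    assume "(((a, b), z), ((a', b'), z')) \<in> hirzebruch_rel n"
    then show "(((a', b'), z'), ((a, b), z)) \<in> hirzebruch_rel n"
      by (cases a; cases b; cases a'; cases b')
         (auto simp: hirzebruch_rel_def fibre_change_def vec2_eq_iff field_simps)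
  qed
  show "trans (hirzebruch_rel n)"
  proof (rule transI, clarify)
    fix a b z a' b' z' a'' b'' z''
    assume "(((a, b), z), ((a', b'), z')) \<in> hirzebruch_rel n"
      and "(((a', b'), z'), ((a'', b''), z'')) \<in> hirzebruch_rel n"
    then show "(((a, b), z), ((a'', b''), z'')) \<in> hirzebruch_rel n"
      by (cases a; cases b; cases a'; cases b'; cases a''; cases b'')
         (auto simp: hirzebruch_rel_def fibre_change_def vec2_eq_iff field_simps)
  qed
qed


section \<open>The metrics \<open>\<omega>\<^sub>s\<close>\<close>

text \<open>
  In the charts with fibre coordinate \<open>1 / z\<^sub>2\<close> the local potential is the one in \<open>(z\<^sub>1, z\<^sub>2)\<close>
  plus \<open>s\<close> times the logarithm of the squared modulus of \<open>1 / z\<^sub>2\<close>.  The lemmas below show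
  that on each overlap any two potentials differ by the real part of a local holomorphic
  function.  Hence their complex Hessians define one global metric, the extension of \<open>\<omega>\<^sub>s\<close>.
\<close>

fun potential :: "nat \<Rightarrow> real \<Rightarrow> hchart \<Rightarrow> complex^2 \<Rightarrow> real" where
  "potential n s (a, Fib0) z =
     ln (1 + (cmod (z$1))\<^sup>2) + s * ln ((1 + (cmod (z$1))\<^sup>2) ^ n + (cmod (z$2))\<^sup>2)"
| "potential n s (a, FibInf) z =
     ln (1 + (cmod (z$1))\<^sup>2) + s * ln ((1 + (cmod (z$1))\<^sup>2) ^ n * (cmod (z$2))\<^sup>2 + 1)"

lemma potential_base_change:
  assumes "z$1 \<noteq> 0" "a \<noteq> a'"
  shows "potential n s (a', Fib0) (transition n (a, Fib0) (a', Fib0) z)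
           = potential n s (a, Fib0) z - (1 + s * real n) * ln ((cmod (z$1))\<^sup>2)"
    and "potential n s (a', FibInf) (transition n (a, FibInf) (a', FibInf) z)
           = potential n s (a, FibInf) z - ln ((cmod (z$1))\<^sup>2)"
proof -
  define r where "r = (cmod (z$1))\<^sup>2"
  define t where "t = (cmod (z$2))\<^sup>2"
  have r: "r > 0" and t: "t \<ge> 0" using assms by (auto simp: r_def t_def)
  have pos: "(1 + r) ^ n + t > 0" using r t by (intro add_pos_nonneg) auto
  have sq: "(cmod (z$1) ^ n)\<^sup>2 = r ^ n" by (simp add: r_def power_mult [symmetric] mult.commute)
  have e: "1 + 1 / r = (1 + r) / r" using r by (simp add: field_simps)
  have l1: "ln (1 + 1 / r) = ln (1 + r) - ln r"
    unfolding e using r by (simp add: ln_div)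
  have ep: "(1 + 1 / r) ^ n = (1 + r) ^ n / r ^ n"
    unfolding e by (rule power_divide)
  have "(1 + 1 / r) ^ n + t / r ^ n = ((1 + r) ^ n + t) / r ^ n"
    unfolding ep by (rule add_divide_distrib [symmetric])
  then have l2: "ln ((1 + 1 / r) ^ n + t / r ^ n) = ln ((1 + r) ^ n + t) - real n * ln r"
    using r pos by (simp add: ln_div ln_realpow)
  have l3: "(1 + 1 / r) ^ n * (r ^ n * t) = (1 + r) ^ n * t"
    unfolding ep using r by simp
  show "potential n s (a', Fib0) (transition n (a, Fib0) (a', Fib0) z)
           = potential n s (a, Fib0) z - (1 + s * real n) * ln ((cmod (z$1))\<^sup>2)"
    using assms l1 l2
    by (simp add: norm_divide norm_power power_divide sq flip: r_def t_def)
       (simp add: algebra_simps)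
  show "potential n s (a', FibInf) (transition n (a, FibInf) (a', FibInf) z)
           = potential n s (a, FibInf) z - ln ((cmod (z$1))\<^sup>2)"
    using assms l1
    by (simp add: norm_divide norm_power norm_mult power_divide power_mult_distrib sq l3
          flip: r_def t_def)
qed

lemma potential_fibre_change:
  assumes "z$2 \<noteq> 0"
  shows "potential n s (a, FibInf) (transition n (a, Fib0) (a, FibInf) z)
           = potential n s (a, Fib0) z - s * ln ((cmod (z$2))\<^sup>2)"
proof -
  define r where "r = (cmod (z$1))\<^sup>2"
  define t where "t = (cmod (z$2))\<^sup>2"
  have r: "r \<ge> 0" and t: "t > 0" using assms by (auto simp: r_def t_def)
  have pos: "(1 + r) ^ n + t > 0" using r t by (intro add_nonneg_pos) auto
  have "(1 + r) ^ n / t + 1 = ((1 + r) ^ n + t) / t"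
    using t by (simp add: add_divide_distrib)
  then have "ln ((1 + r) ^ n / t + 1) = ln ((1 + r) ^ n + t) - ln t"
    using t pos by (simp add: ln_div)
  then show ?thesis
    by (simp add: fibre_change_def norm_divide power_divide flip: r_def t_def)
       (simp add: algebra_simps)
qed

definition omega :: "nat \<Rightarrow> real \<Rightarrow> hchart \<Rightarrow> 2 chart_metric" where
  "omega n s c = complex_hessian (potential n s c)"

end

theory Submission
  imports Defs
begin

text \<open>
  In every chart the potential of \<open>\<omega>\<^sub>s\<close> is \<open>A ln u + s ln (1 + u\<^sup>k |z\<^sub>2|\<^sup>2)\<close> with
  \<open>u = 1 + |z\<^sub>1|\<^sup>2\<close>, where \<open>(A, k) = (1, n)\<close> or \<open>(1 + s n, - n)\<close>
  (\<open>potential_eq_bundle_potential\<close>).  The metric thus comes from a Hermitian line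
  bundle over the projective line, and the Chern connection splits tangent vectors orthogonally into
  a horizontal and a vertical part of squared lengths \<open>X\<close> and \<open>V\<close>.  Because of the symmetry, the
  curvature tensor contracted four times with one vector is a quadratic form in \<open>(X, V)\<close> whose
  coefficients depend only on \<open>y = u\<^sup>n / (u\<^sup>n + |z\<^sub>2|\<^sup>2)\<close>, with \<open>z\<^sub>2\<close> the coordinate of the
  charts \<open>Fib0\<close>:
  \<open>K = 4 (p X\<^sup>2 + 2 q X V + V\<^sup>2 / s) / (X + V)\<^sup>2\<close>.  This formula is obtained by direct
  differentiation along the given vector (\<open>curvature_quartic\<close>, \<open>bundle_curvature\<close>,
  \<open>bundle_hsc_normalised\<close>).

  At \<open>y = 0\<close> one has \<open>p = 1\<close> and \<open>q = - n\<close>, so \<open>K\<close> takes the values \<open>4 / s\<close> and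
  \<open>4 (1 - s n\<^sup>2) / (1 + s + 2 n s)\<close> (\<open>hsc_origin_special\<close>).  Their ratio is at most
  \<open>1 / (1 + 2 n)\<^sup>2\<close> for each \<open>s\<close>, the difference being a perfect square that vanishes for
  \<open>s = 1 / (2 n\<^sup>2 + n)\<close> (\<open>pinching_le\<close>).  For this \<open>s\<close> the two values are the global extrema: an
  explicit discriminant is nonnegative for all \<open>y\<close> in the unit interval
  (\<open>pinching_form_bounds\<close>).
\<close>

section \<open>Wirtinger derivatives in a fixed direction\<close>

text \<open>
  A real-differentiable \<open>f\<close> has derivative \<open>h \<mapsto> P(h) + Q(h)\<close> with \<open>P\<close> complex-linear and \<open>Q\<close>
  conjugate-linear, and \<open>p = P(\<xi>)\<close>, \<open>q = Q(\<xi>)\<close> can be read off from its values at \<open>\<xi>\<close> and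
  \<open>\<i>\<xi>\<close>.  For \<open>\<xi>\<close> a coordinate vector they are the two Wirtinger derivatives.  A general
  direction is allowed because the holomorphic sectional curvature contracts every differentiation
  index with the same vector, so that two directional derivatives replace all the components.
\<close>
definition has_wirtinger ::
  "(complex^'m::finite \<Rightarrow> complex) \<Rightarrow> complex^'m \<Rightarrow> complex \<Rightarrow> complex \<Rightarrow> complex^'m \<Rightarrow> bool" where
  "has_wirtinger f \<xi> p q z \<longleftrightarrow>
     (\<exists>f'. (f has_derivative f') (at z) \<and> f' \<xi> = p + q \<and> f' (\<i> *s \<xi>) = \<i> * (p - q))"

lemma has_wirtinger_eq_rhs:
  "has_wirtinger f \<xi> p q z \<Longrightarrow> p = p' \<Longrightarrow> q = q' \<Longrightarrow> has_wirtinger f \<xi> p' q' z"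
  by simp

lemma has_wirtinger_const: "has_wirtinger (\<lambda>_. a) \<xi> 0 0 z"
  unfolding has_wirtinger_def by (rule exI[of _ "\<lambda>_. 0"]) simp

lemma has_wirtinger_coord: "has_wirtinger (\<lambda>w. w $ k) \<xi> (\<xi> $ k) 0 z"
  unfolding has_wirtinger_def
  by (rule exI[of _ "\<lambda>h. h $ k"])
     (auto intro!: bounded_linear_imp_has_derivative bounded_linear_vec_nth)

lemma has_wirtinger_cnj:
  assumes "has_wirtinger f \<xi> p q z"
  shows "has_wirtinger (\<lambda>w. cnj (f w)) \<xi> (cnj q) (cnj p) z"
proof -
  obtain f' where f': "(f has_derivative f') (at z)" "f' \<xi> = p + q" "f' (\<i> *s \<xi>) = \<i> * (p - q)"
    using assms unfolding has_wirtinger_def by blast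
  show ?thesis
    unfolding has_wirtinger_def
    by (intro exI[of _ "\<lambda>h. cnj (f' h)"] conjI has_derivative_cnj f'(1))
       (simp_all add: f'(2,3) algebra_simps)
qed

lemma has_wirtinger_add:
  assumes "has_wirtinger f \<xi> p q z" "has_wirtinger g \<xi> p' q' z"
  shows "has_wirtinger (\<lambda>w. f w + g w) \<xi> (p + p') (q + q') z"
proof -
  obtain f' where f': "(f has_derivative f') (at z)" "f' \<xi> = p + q" "f' (\<i> *s \<xi>) = \<i> * (p - q)"
    using assms unfolding has_wirtinger_def by blast
  obtain g' where g': "(g has_derivative g') (at z)" "g' \<xi> = p' + q'"
      "g' (\<i> *s \<xi>) = \<i> * (p' - q')"
    using assms unfolding has_wirtinger_def by blast
  show ?thesis
    unfolding has_wirtinger_def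
    by (intro exI[of _ "\<lambda>h. f' h + g' h"] conjI has_derivative_add f'(1) g'(1))
       (simp_all add: f'(2,3) g'(2,3) algebra_simps)
qed

lemma has_wirtinger_mult:
  assumes "has_wirtinger f \<xi> p q z" "has_wirtinger g \<xi> p' q' z"
  shows "has_wirtinger (\<lambda>w. f w * g w) \<xi> (p * g z + f z * p') (q * g z + f z * q') z"
proof -
  obtain f' where f': "(f has_derivative f') (at z)" "f' \<xi> = p + q" "f' (\<i> *s \<xi>) = \<i> * (p - q)"
    using assms unfolding has_wirtinger_def by blast
  obtain g' where g': "(g has_derivative g') (at z)" "g' \<xi> = p' + q'"
      "g' (\<i> *s \<xi>) = \<i> * (p' - q')"
    using assms unfolding has_wirtinger_def by blast
  show ?thesis
    unfolding has_wirtinger_def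
    by (intro exI[of _ "\<lambda>h. f z * g' h + f' h * g z"] conjI has_derivative_mult f'(1) g'(1))
       (simp_all add: f'(2,3) g'(2,3) algebra_simps)
qed

lemma has_wirtinger_diff:
  assumes "has_wirtinger f \<xi> p q z" "has_wirtinger g \<xi> p' q' z"
  shows "has_wirtinger (\<lambda>w. f w - g w) \<xi> (p - p') (q - q') z"
  using has_wirtinger_add[OF assms(1) has_wirtinger_mult[OF has_wirtinger_const[of "-1"] assms(2)]]
  by simp

lemma has_wirtinger_square:
  "has_wirtinger f \<xi> p q z \<Longrightarrow> has_wirtinger (\<lambda>w. (f w)\<^sup>2) \<xi> (2 * f z * p) (2 * f z * q) z"
  unfolding power2_eq_square by (rule has_wirtinger_eq_rhs[OF has_wirtinger_mult]) auto

lemma has_wirtinger_sum: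
  assumes "\<And>i. i \<in> I \<Longrightarrow> has_wirtinger (f i) \<xi> (p i) (q i) z"
  shows "has_wirtinger (\<lambda>w. \<Sum>i\<in>I. f i w) \<xi> (\<Sum>i\<in>I. p i) (\<Sum>i\<in>I. q i) z"
  using assms
  by (induction I rule: infinite_finite_induct)
     (auto intro!: has_wirtinger_const has_wirtinger_add)

lemma has_wirtinger_compose:
  assumes "has_wirtinger f \<xi> p q z" "(F has_field_derivative d) (at (f z))"
  shows "has_wirtinger (\<lambda>w. F (f w)) \<xi> (d * p) (d * q) z"
proof -
  obtain f' where f': "(f has_derivative f') (at z)" "f' \<xi> = p + q" "f' (\<i> *s \<xi>) = \<i> * (p - q)"
    using assms unfolding has_wirtinger_def by blast
  have "((\<lambda>w. F (f w)) has_derivative (\<lambda>h. d * f' h)) (at z)"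
    using has_derivative_compose[OF f'(1)] assms(2) by (auto simp: has_field_derivative_def)
  then show ?thesis
    unfolding has_wirtinger_def
    by (intro exI[of _ "\<lambda>h. d * f' h"]) (simp add: f'(2,3) algebra_simps)
qed

lemma has_wirtinger_inverse:
  assumes "has_wirtinger f \<xi> p q z" "f z \<noteq> 0"
  shows "has_wirtinger (\<lambda>w. inverse (f w)) \<xi>
           (- (inverse (f z))\<^sup>2 * p) (- (inverse (f z))\<^sup>2 * q) z"
  using has_wirtinger_compose[OF assms(1) DERIV_inverse[OF assms(2)]]
  by (simp add: power2_eq_square)

lemma has_wirtinger_power_int:
  assumes "has_wirtinger f \<xi> p q z" "f z \<noteq> 0"
  shows "has_wirtinger (\<lambda>w. f w powi k) \<xi>
           (of_int k * f z powi (k - 1) * p) (of_int k * f z powi (k - 1) * q) z"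
proof (rule has_wirtinger_compose[OF assms(1)])
  show "((\<lambda>x. x powi k) has_field_derivative of_int k * f z powi (k - 1)) (at (f z))"
    using assms(2) by (auto intro!: derivative_eq_intros)
qed

text \<open>The derivative of a real-valued function is real-valued itself, so it can be fed to the
  real chain rule and back without loss.\<close>

lemma has_wirtinger_ln:
  assumes "has_wirtinger (\<lambda>w. complex_of_real (r w)) \<xi> p q z" "r z > 0"
  shows "has_wirtinger (\<lambda>w. complex_of_real (ln (r w))) \<xi> (p / r z) (q / r z) z"
proof -
  obtain f' where f': "((\<lambda>w. complex_of_real (r w)) has_derivative f') (at z)"
      "f' \<xi> = p + q" "f' (\<i> *s \<xi>) = \<i> * (p - q)"
    using assms unfolding has_wirtinger_def by blast
  have dr: "(r has_derivative (\<lambda>h. Re (f' h))) (at z)"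
    using has_derivative_Re[OF f'(1)] by simp
  have "((\<lambda>w. 0) has_derivative (\<lambda>h. Im (f' h))) (at z)"
    using has_derivative_Im[OF f'(1)] by simp
  then have "Im (f' h) = 0" for h
    by (metis has_derivative_const has_derivative_unique)
  then have re: "complex_of_real (Re (f' h)) = f' h" for h
    by (simp add: complex_eq_iff)
  have "((\<lambda>w. ln (r w)) has_derivative (\<lambda>h. Re (f' h) * inverse (r z))) (at z)"
    using has_derivative_ln[OF assms(2) dr] by simp
  then have "((\<lambda>w. complex_of_real (ln (r w))) has_derivative
       (\<lambda>h. complex_of_real (Re (f' h) * inverse (r z)))) (at z)"
    by (rule has_derivative_of_real)
  then have "((\<lambda>w. complex_of_real (ln (r w))) has_derivative (\<lambda>h. f' h / r z)) (at z)"
    by (simp add: re divide_inverse of_real_inverse flip: of_real_inverse)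
  then show ?thesis
    unfolding has_wirtinger_def
    by (intro exI[of _ "\<lambda>h. f' h / r z"]) (simp add: f'(2,3) add_divide_distrib diff_divide_distrib
        right_diff_distrib)
qed

lemma has_wirtinger_unique:
  assumes "has_wirtinger f \<xi> p q z" "has_wirtinger f \<xi> p' q' z"
  shows "p = p'" "q = q'"
proof -
  obtain f' where f': "(f has_derivative f') (at z)" "f' \<xi> = p + q" "f' (\<i> *s \<xi>) = \<i> * (p - q)"
    using assms unfolding has_wirtinger_def by blast
  obtain f'' where f'': "(f has_derivative f'') (at z)" "f'' \<xi> = p' + q'"
      "f'' (\<i> *s \<xi>) = \<i> * (p' - q')"
    using assms unfolding has_wirtinger_def by blast
  have "f' = f''" using has_derivative_unique f'(1) f''(1) by blast
  then have "p + q = p' + q'" "p - q = p' - q'" using f' f'' by auto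
  then show "p = p'" "q = q'"
    by (auto simp: complex_eq_iff)
qed

lemma partial_eq_derivative:
  assumes "(f has_derivative f') (at z)"
  shows "partial_re k f z = f' (axis k 1)" "partial_im k f z = f' (axis k \<i>)"
proof -
  have bl: "bounded_linear f'" using assms by (rule has_derivative_bounded_linear)
  have line: "vector_derivative (\<lambda>t::real. f (z + axis k (c * of_real t))) (at 0) = f' (axis k c)" for c
  proof -
    have ax: "axis k (c * of_real t) = t *\<^sub>R axis k c" for t :: real
      by (simp add: axis_def vec_eq_iff complex_eq_iff)
    have "((\<lambda>t::real. z + t *\<^sub>R axis k c) has_derivative (\<lambda>t. t *\<^sub>R axis k c)) (at 0)"
      by (auto intro!: derivative_eq_intros)
    then have "((\<lambda>t::real. f (z + t *\<^sub>R axis k c)) has_derivative (\<lambda>t. f' (t *\<^sub>R axis k c))) (at 0)"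
      by (rule has_derivative_compose) (use assms in simp)
    then have "((\<lambda>t::real. f (z + axis k (c * of_real t))) has_vector_derivative f' (axis k c)) (at 0)"
      unfolding has_vector_derivative_def ax
      by (simp add: linear_simps(5)[OF bl])
    then show ?thesis by (rule vector_derivative_at)
  qed
  show "partial_re k f z = f' (axis k 1)" using line[of 1] by (simp add: partial_re_def)
  show "partial_im k f z = f' (axis k \<i>)" using line[of \<i>] by (simp add: partial_im_def)
qed

lemma has_wirtinger_axis:
  assumes "has_wirtinger f (axis k 1) p q z"
  shows "wirtinger k f z = p" "wirtinger_bar k f z = q"
proof -
  obtain f' where f': "(f has_derivative f') (at z)" "f' (axis k 1) = p + q"
      "f' (\<i> *s axis k 1) = \<i> * (p - q)"
    using assms unfolding has_wirtinger_def by blast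
  have ax: "\<i> *s axis k 1 = axis k \<i>"
    by (simp add: vec_eq_iff axis_def)
  note d = partial_eq_derivative[OF f'(1), of k]
  show "wirtinger k f z = p" "wirtinger_bar k f z = q"
    using f'(2,3) by (simp_all add: wirtinger_def wirtinger_bar_def d ax flip: mult.assoc)
qed

text \<open>
  The derivative at an arbitrary \<open>\<xi>\<close> is recovered by decomposing \<open>\<xi>\<close> into real multiples of the
  coordinate vectors and of their products with \<open>\<i>\<close>.
\<close>

lemma has_wirtinger_partials:
  fixes f :: "complex^'m::finite \<Rightarrow> complex"
  assumes "f differentiable (at z)"
  shows "has_wirtinger f \<xi> (\<Sum>k\<in>UNIV. \<xi> $ k * wirtinger k f z)
           (\<Sum>k\<in>UNIV. cnj (\<xi> $ k) * wirtinger_bar k f z) z"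
proof -
  obtain f' where f': "(f has_derivative f') (at z)"
    using assms unfolding differentiable_def by blast
  interpret bounded_linear f' using f' by (rule has_derivative_bounded_linear)
  note d = partial_eq_derivative[OF f']
  have split: "axis k c = Re c *\<^sub>R axis k 1 + Im c *\<^sub>R axis k \<i>" for c and k :: 'm
    by (simp add: vec_eq_iff axis_def complex_eq_iff)
  have ax: "f' (axis k c) = c * wirtinger k f z + cnj c * wirtinger_bar k f z" for k c
    unfolding split[of k c] wirtinger_def wirtinger_bar_def d
    by (simp add: add scaleR complex_eq_iff field_simps)
  have expand: "f' h = (\<Sum>k\<in>UNIV. f' (axis k (h $ k)))" for h
  proof -
    have "h = (\<Sum>k\<in>UNIV. axis k (h $ k))"
      by (simp add: vec_eq_iff axis_def if_distrib sum.delta cong: if_cong)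
    then show ?thesis by (metis sum)
  qed
  show ?thesis
    unfolding has_wirtinger_def
    by (rule exI[of _ f'], intro conjI f')
       (simp_all add: expand[of \<xi>] expand[of "\<i> *s \<xi>"] ax sum.distrib sum_subtractf
         sum_distrib_left algebra_simps)
qed

lemma has_wirtinger_imp_differentiable:
  "has_wirtinger f \<xi> p q z \<Longrightarrow> f differentiable (at z)"
  unfolding has_wirtinger_def differentiable_def by blast

section \<open>The curvature along one direction\<close>

text \<open>
  Pulling finite sums through iterated Wirtinger derivatives requires differentiability at every
  stage.  The following ring contains all coefficients of the metrics and is closed under
  both Wirtinger derivations, hence consists of infinitely differentiable functions.
\<close>

inductive rational_zzbar :: "(complex^'m::finite \<Rightarrow> complex) \<Rightarrow> bool" where
  const: "rational_zzbar (\<lambda>_. a)"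
| coord: "rational_zzbar (\<lambda>z. z $ k)"
| coord_bar: "rational_zzbar (\<lambda>z. cnj (z $ k))"
| add: "rational_zzbar f \<Longrightarrow> rational_zzbar g \<Longrightarrow> rational_zzbar (\<lambda>z. f z + g z)"
| mult: "rational_zzbar f \<Longrightarrow> rational_zzbar g \<Longrightarrow> rational_zzbar (\<lambda>z. f z * g z)"
| inverse: "rational_zzbar f \<Longrightarrow> (\<And>z. f z \<noteq> 0) \<Longrightarrow> rational_zzbar (\<lambda>z. inverse (f z))"

lemma rational_zzbar_diff:
  assumes "rational_zzbar f" "rational_zzbar g"
  shows "rational_zzbar (\<lambda>z. f z - g z)"
  using rational_zzbar.add[OF assms(1) rational_zzbar.mult[OF rational_zzbar.const[of "-1"] assms(2)]]
  by simp

lemma rational_zzbar_power: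
  assumes "rational_zzbar f"
  shows "rational_zzbar (\<lambda>z. f z ^ n)"
  by (induction n) (auto intro: rational_zzbar.intros assms)

lemma rational_zzbar_power_int:
  assumes "rational_zzbar f" "\<And>z. f z \<noteq> 0"
  shows "rational_zzbar (\<lambda>z. f z powi k)"
  using assms
  by (cases "k \<ge> 0")
     (auto simp: power_int_def intro!: rational_zzbar_power rational_zzbar.inverse)

lemma rational_zzbar_partials:
  assumes "rational_zzbar f"
  shows "\<exists>P Q. (\<forall>k. rational_zzbar (P k) \<and> rational_zzbar (Q k)) \<and>
           (\<forall>k z. has_wirtinger f (axis k 1) (P k z) (Q k z) z)"
  using assms
proof induction
  case (const a)
  then show ?case
    by (intro exI[of _ "\<lambda>_ _. 0"]) (auto intro: rational_zzbar.const has_wirtinger_const)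
next
  case (coord j)
  then show ?case
    by (intro exI[of _ "\<lambda>k _. axis k 1 $ j"] exI[of _ "\<lambda>_ _. 0"])
       (auto intro: rational_zzbar.const has_wirtinger_coord)
next
  case (coord_bar j)
  have "has_wirtinger (\<lambda>z. cnj (z $ j)) (axis k 1) 0 (cnj (axis k 1 $ j)) z" for k z
    using has_wirtinger_cnj[OF has_wirtinger_coord] by simp
  then show ?case
    by (intro exI[of _ "\<lambda>_ _. 0"] exI[of _ "\<lambda>k _. cnj (axis k 1 $ j)"])
       (auto intro: rational_zzbar.const)
next
  case (add f g)
  then obtain P Q P' Q' where
    "\<forall>k. rational_zzbar (P k) \<and> rational_zzbar (Q k)"
    "\<forall>k z. has_wirtinger f (axis k 1) (P k z) (Q k z) z"
    "\<forall>k. rational_zzbar (P' k) \<and> rational_zzbar (Q' k)"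
    "\<forall>k z. has_wirtinger g (axis k 1) (P' k z) (Q' k z) z" by blast
  then show ?case
    by (intro exI[of _ "\<lambda>k z. P k z + P' k z"] exI[of _ "\<lambda>k z. Q k z + Q' k z"])
       (auto intro!: rational_zzbar.add has_wirtinger_add)
next
  case (mult f g)
  then obtain P Q P' Q' where
    "\<forall>k. rational_zzbar (P k) \<and> rational_zzbar (Q k)"
    "\<forall>k z. has_wirtinger f (axis k 1) (P k z) (Q k z) z"
    "\<forall>k. rational_zzbar (P' k) \<and> rational_zzbar (Q' k)"
    "\<forall>k z. has_wirtinger g (axis k 1) (P' k z) (Q' k z) z" by blast
  with mult.hyps show ?case
    by (intro exI[of _ "\<lambda>k z. P k z * g z + f z * P' k z"]
          exI[of _ "\<lambda>k z. Q k z * g z + f z * Q' k z"])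
       (auto intro!: rational_zzbar.add rational_zzbar.mult has_wirtinger_mult)
next
  case (inverse f)
  then obtain P Q where
    "\<forall>k. rational_zzbar (P k) \<and> rational_zzbar (Q k)"
    "\<forall>k z. has_wirtinger f (axis k 1) (P k z) (Q k z) z" by blast
  moreover have "rational_zzbar (\<lambda>z. - (inverse (f z))\<^sup>2)"
    using rational_zzbar.mult[OF rational_zzbar.const[of "-1"]
        rational_zzbar_power[OF rational_zzbar.inverse[OF inverse.hyps]], of 2] by simp
  ultimately show ?case using inverse.hyps
    by (intro exI[of _ "\<lambda>k z. - (inverse (f z))\<^sup>2 * P k z"]
          exI[of _ "\<lambda>k z. - (inverse (f z))\<^sup>2 * Q k z"] conjI allI
          rational_zzbar.mult has_wirtinger_inverse) auto
qed

lemma rational_zzbar_wirtinger: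
  assumes "rational_zzbar f"
  shows "rational_zzbar (wirtinger k f)" "rational_zzbar (wirtinger_bar k f)"
    "f differentiable (at z)"
proof -
  obtain P Q where *: "\<forall>k. rational_zzbar (P k) \<and> rational_zzbar (Q k)"
    "\<forall>k z. has_wirtinger f (axis k 1) (P k z) (Q k z) z"
    using rational_zzbar_partials[OF assms] by blast
  have "wirtinger k f = P k" "wirtinger_bar k f = Q k"
    using has_wirtinger_axis * by blast+
  with * show "rational_zzbar (wirtinger k f)" "rational_zzbar (wirtinger_bar k f)" by simp_all
  show "f differentiable (at z)" using * has_wirtinger_imp_differentiable by blast
qed

lemmas has_wirtinger_rational = has_wirtinger_partials[OF rational_zzbar_wirtinger(3)]

text \<open>
  For a fixed vector \<open>\<xi>\<close> the fourfold contraction of the curvature is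
  \<open>- D (Dbar N) + \<langle>D G\<xi>, D G\<xi>\<rangle>\<close>, where \<open>N\<close> is the squared length of the constant field \<open>\<xi>\<close>,
  \<open>G\<xi>\<close> is its dual covector and \<open>D\<close>, \<open>Dbar\<close> are the Wirtinger derivatives along \<open>\<xi>\<close>; the
  inner product is the one on covectors.  Since \<open>\<xi>\<close> is constant, this is linearity of
  differentiation.
\<close>

lemma curvature_quartic:
  fixes g :: "'m::finite chart_metric"
  assumes rat: "\<And>i j. rational_zzbar (\<lambda>w. g w $ i $ j)"
    and N: "\<And>w. has_wirtinger (\<lambda>w. \<Sum>i\<in>UNIV. \<Sum>j\<in>UNIV. g w $ i $ j * \<xi> $ i * cnj (\<xi> $ j)) \<xi>
                  (N1 w) (N2 w) w"
    and N2: "has_wirtinger N2 \<xi> N12 x z"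
    and c: "\<And>p. has_wirtinger (\<lambda>w. \<Sum>i\<in>UNIV. \<xi> $ i * g w $ i $ p) \<xi> (c p) (c' p) z"
    and d: "\<And>q. has_wirtinger (\<lambda>w. \<Sum>j\<in>UNIV. cnj (\<xi> $ j) * g w $ q $ j) \<xi> (d' q) (d q) z"
  shows "(\<Sum>i\<in>UNIV. \<Sum>j\<in>UNIV. \<Sum>k\<in>UNIV. \<Sum>l\<in>UNIV.
            curvature g z i j k l * \<xi> $ i * cnj (\<xi> $ j) * \<xi> $ k * cnj (\<xi> $ l))
         = - N12 + (\<Sum>p\<in>UNIV. \<Sum>q\<in>UNIV. matrix_inv (g z) $ p $ q * c p * d q)"
proof -
  let ?g = "\<lambda>i j w. g w $ i $ j"
  have wN: "has_wirtinger (\<lambda>w. \<Sum>i\<in>UNIV. \<Sum>j\<in>UNIV. (\<xi> $ i * cnj (\<xi> $ j)) * g w $ i $ j) \<xi>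
      (\<Sum>i\<in>UNIV. \<Sum>j\<in>UNIV. 0 * g w $ i $ j + (\<xi> $ i * cnj (\<xi> $ j)) * (\<Sum>k\<in>UNIV. \<xi> $ k * wirtinger k (?g i j) w))
      (\<Sum>i\<in>UNIV. \<Sum>j\<in>UNIV. 0 * g w $ i $ j + (\<xi> $ i * cnj (\<xi> $ j)) * (\<Sum>l\<in>UNIV. cnj (\<xi> $ l) * wirtinger_bar l (?g i j) w)) w" for w
    by (intro has_wirtinger_sum has_wirtinger_mult has_wirtinger_const has_wirtinger_rational rat)
  have "(\<lambda>w. \<Sum>i\<in>UNIV. \<Sum>j\<in>UNIV. (\<xi> $ i * cnj (\<xi> $ j)) * g w $ i $ j)
      = (\<lambda>w. \<Sum>i\<in>UNIV. \<Sum>j\<in>UNIV. g w $ i $ j * \<xi> $ i * cnj (\<xi> $ j))"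
    by (simp add: mult_ac)
  with wN N have "N2 w = (\<Sum>i\<in>UNIV. \<Sum>j\<in>UNIV. 0 * g w $ i $ j + (\<xi> $ i * cnj (\<xi> $ j)) *
      (\<Sum>l\<in>UNIV. cnj (\<xi> $ l) * wirtinger_bar l (?g i j) w))" for w
    by (metis (no_types, lifting) has_wirtinger_unique(2))
  then have N2_eq: "N2 = (\<lambda>w. \<Sum>i\<in>UNIV. \<Sum>j\<in>UNIV. (\<xi> $ i * cnj (\<xi> $ j)) *
      (\<Sum>l\<in>UNIV. cnj (\<xi> $ l) * wirtinger_bar l (?g i j) w))" by (simp add: fun_eq_iff)
  have "has_wirtinger N2 \<xi>
      (\<Sum>i\<in>UNIV. \<Sum>j\<in>UNIV. 0 * (\<Sum>l\<in>UNIV. cnj (\<xi> $ l) * wirtinger_bar l (?g i j) z) + (\<xi> $ i * cnj (\<xi> $ j)) *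
         (\<Sum>l\<in>UNIV. 0 * wirtinger_bar l (?g i j) z + cnj (\<xi> $ l) * (\<Sum>k\<in>UNIV. \<xi> $ k * wirtinger k (wirtinger_bar l (?g i j)) z)))
      (\<Sum>i\<in>UNIV. \<Sum>j\<in>UNIV. 0 * (\<Sum>l\<in>UNIV. cnj (\<xi> $ l) * wirtinger_bar l (?g i j) z) + (\<xi> $ i * cnj (\<xi> $ j)) *
         (\<Sum>l\<in>UNIV. 0 * wirtinger_bar l (?g i j) z + cnj (\<xi> $ l) * (\<Sum>k\<in>UNIV. cnj (\<xi> $ k) * wirtinger_bar k (wirtinger_bar l (?g i j)) z))) z"
    unfolding N2_eq
    by (intro has_wirtinger_sum has_wirtinger_mult has_wirtinger_const has_wirtinger_rational
        rational_zzbar_wirtinger(2) rat)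
  from has_wirtinger_unique(1)[OF N2 this]
  have N12: "N12 = (\<Sum>i\<in>UNIV. \<Sum>j\<in>UNIV. \<Sum>l\<in>UNIV. \<Sum>k\<in>UNIV.
      wirtinger k (wirtinger_bar l (?g i j)) z * \<xi> $ i * cnj (\<xi> $ j) * \<xi> $ k * cnj (\<xi> $ l))"
    by (simp add: sum_distrib_left mult_ac)
  have "has_wirtinger (\<lambda>w. \<Sum>i\<in>UNIV. \<xi> $ i * g w $ i $ p) \<xi>
      (\<Sum>i\<in>UNIV. 0 * g z $ i $ p + \<xi> $ i * (\<Sum>k\<in>UNIV. \<xi> $ k * wirtinger k (?g i p) z))
      (\<Sum>i\<in>UNIV. 0 * g z $ i $ p + \<xi> $ i * (\<Sum>k\<in>UNIV. cnj (\<xi> $ k) * wirtinger_bar k (?g i p) z)) z" for p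
    by (intro has_wirtinger_sum has_wirtinger_mult has_wirtinger_const has_wirtinger_rational rat)
  from has_wirtinger_unique(1)[OF c this]
  have cp: "c p = (\<Sum>i\<in>UNIV. \<Sum>k\<in>UNIV. wirtinger k (?g i p) z * \<xi> $ i * \<xi> $ k)" for p
    by (simp add: sum_distrib_left mult_ac)
  have "has_wirtinger (\<lambda>w. \<Sum>j\<in>UNIV. cnj (\<xi> $ j) * g w $ q $ j) \<xi>
      (\<Sum>j\<in>UNIV. 0 * g z $ q $ j + cnj (\<xi> $ j) * (\<Sum>k\<in>UNIV. \<xi> $ k * wirtinger k (?g q j) z))
      (\<Sum>j\<in>UNIV. 0 * g z $ q $ j + cnj (\<xi> $ j) * (\<Sum>l\<in>UNIV. cnj (\<xi> $ l) * wirtinger_bar l (?g q j) z)) z" for q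
    by (intro has_wirtinger_sum has_wirtinger_mult has_wirtinger_const has_wirtinger_rational rat)
  from has_wirtinger_unique(2)[OF d this]
  have dq: "d q = (\<Sum>j\<in>UNIV. \<Sum>l\<in>UNIV. wirtinger_bar l (?g q j) z * cnj (\<xi> $ j) * cnj (\<xi> $ l))" for q
    by (simp add: sum_distrib_left mult_ac)
  have lin: "(\<Sum>i\<in>UNIV. \<Sum>j\<in>UNIV. \<Sum>k\<in>UNIV. \<Sum>l\<in>UNIV.
      (\<Sum>p\<in>UNIV. \<Sum>q\<in>UNIV. matrix_inv (g z) $ p $ q * wirtinger k (?g i p) z * wirtinger_bar l (?g q j) z)
         * \<xi> $ i * cnj (\<xi> $ j) * \<xi> $ k * cnj (\<xi> $ l))
      = (\<Sum>p\<in>UNIV. \<Sum>q\<in>UNIV. matrix_inv (g z) $ p $ q * c p * d q)" (is "?L = ?R")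
  proof -
    define X where "X i j k l p q = matrix_inv (g z) $ p $ q * wirtinger k (?g i p) z * wirtinger_bar l (?g q j) z
        * \<xi> $ i * cnj (\<xi> $ j) * \<xi> $ k * cnj (\<xi> $ l)" for i j k l p q
    have "?L = (\<Sum>i\<in>UNIV. \<Sum>j\<in>UNIV. \<Sum>k\<in>UNIV. \<Sum>l\<in>UNIV. \<Sum>p\<in>UNIV. \<Sum>q\<in>UNIV. X i j k l p q)"
      by (simp add: X_def sum_distrib_right)
    also have "\<dots> = (\<Sum>(i,j,k,l,p,q)\<in>UNIV. X i j k l p q)"
      by (simp add: sum.cartesian_product flip: UNIV_Times_UNIV)
    also have "\<dots> = (\<Sum>(p,q,i,k,j,l)\<in>UNIV. X i j k l p q)"
      by (rule sum.reindex_bij_witness[of _ "\<lambda>(p,q,i,k,j,l). (i,j,k,l,p,q)" "\<lambda>(i,j,k,l,p,q). (p,q,i,k,j,l)"]) auto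
    also have "\<dots> = (\<Sum>p\<in>UNIV. \<Sum>q\<in>UNIV. \<Sum>i\<in>UNIV. \<Sum>k\<in>UNIV. \<Sum>j\<in>UNIV. \<Sum>l\<in>UNIV. X i j k l p q)"
      by (simp add: sum.cartesian_product flip: UNIV_Times_UNIV)
    also have "\<dots> = ?R"
      by (simp add: X_def cp dq sum_distrib_left sum_distrib_right mult_ac)
    finally show ?thesis .
  qed
  have swap: "(\<Sum>k\<in>UNIV. \<Sum>l\<in>UNIV. F k l) = (\<Sum>l\<in>UNIV. \<Sum>k\<in>UNIV. F k l)"
    for F :: "'m \<Rightarrow> 'm \<Rightarrow> complex" by (rule sum.swap)
  show ?thesis
    unfolding lin[symmetric] N12
    by (subst (2) swap) (simp add: curvature_def ring_distribs sum.distrib sum_negf sum_subtractf)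
qed

section \<open>A Hermitian line bundle over the projective line\<close>

text \<open>
  On the total space of a line bundle with fibre coordinate \<open>z\<^sub>2\<close> and fibre norm
  \<open>base_norm ^ k * |z\<^sub>2|\<^sup>2\<close> all functions of interest are polynomials in the coordinates, their
  conjugates, \<open>base_inv\<close>, \<open>fibre_weight\<close> and \<open>fibre_inv\<close>.  The directional derivatives of these
  generators close up once the logarithmic derivative of \<open>base_norm\<close> and the vertical part of the
  direction are given names.
\<close>

definition base_norm :: "complex^2 \<Rightarrow> complex" where
  "base_norm z = 1 + z $ 1 * cnj (z $ 1)"

definition fibre_weight :: "int \<Rightarrow> complex^2 \<Rightarrow> complex" where
  "fibre_weight k z = base_norm z powi k"

definition base_inv :: "complex^2 \<Rightarrow> complex" where
  "base_inv z = inverse (base_norm z)"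

definition fibre_inv :: "int \<Rightarrow> complex^2 \<Rightarrow> complex" where
  "fibre_inv k z = inverse (1 + fibre_weight k z * (z $ 2 * cnj (z $ 2)))"

text \<open>
  The holomorphic derivative of the logarithm of \<open>base_norm\<close> along \<open>\<xi>\<close>; times \<open>k\<close>, it is the
  connection form of the Chern connection of the line bundle.
\<close>

definition dlog_base :: "complex^2 \<Rightarrow> complex^2 \<Rightarrow> complex" where
  "dlog_base \<xi> z = cnj (z $ 1) * base_inv z * \<xi> $ 1"

text \<open>
  The squared length of the horizontal lift of a Fubini-Study unit vector; it interpolates linearly
  between \<open>A\<close> on the zero section and \<open>A + s k\<close> at infinity.
\<close>

definition horizontal_coeff :: "real \<Rightarrow> int \<Rightarrow> real \<Rightarrow> complex^2 \<Rightarrow> complex" where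
  "horizontal_coeff A k s z = of_real A + of_real s * of_int k * (1 - fibre_inv k z)"

text \<open>
  The covariant derivative of the fibre coordinate along \<open>\<xi>\<close>, so that the horizontal vectors are its
  kernel.
\<close>

definition vertical :: "int \<Rightarrow> complex^2 \<Rightarrow> complex^2 \<Rightarrow> complex" where
  "vertical k \<xi> z = \<xi> $ 2 + of_int k * dlog_base \<xi> z * z $ 2"

lemma base_norm_of_real: "base_norm z = of_real (1 + (cmod (z $ 1))\<^sup>2)"
  by (simp only: base_norm_def complex_norm_square of_real_add of_real_1)

lemma cnj_base_norm [simp]: "cnj (base_norm z) = base_norm z"
  by (simp add: base_norm_def)

lemma base_norm_nonzero [simp]: "base_norm z \<noteq> 0"
  unfolding base_norm_of_real of_real_eq_0_iff
  by (metis add_pos_nonneg less_irrefl zero_le_power2 zero_less_one)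

lemma fibre_weight_of_real: "fibre_weight k z = of_real ((1 + (cmod (z $ 1))\<^sup>2) powi k)"
  by (simp add: fibre_weight_def base_norm_of_real of_real_power_int)

lemma base_pos: "1 + (cmod (z $ 1))\<^sup>2 > 0" for z :: "complex^2"
  by (simp add: add_pos_nonneg)

lemma fibre_norm_pos: "1 + (1 + (cmod (z $ 1))\<^sup>2) powi k * (cmod (z $ 2))\<^sup>2 > 0" for z :: "complex^2"
  by (intro add_pos_nonneg mult_nonneg_nonneg zero_le_power_int)
     (auto simp: add_nonneg_nonneg)

lemma fibre_norm_of_real:
  "1 + fibre_weight k z * (z $ 2 * cnj (z $ 2)) =
     of_real (1 + (1 + (cmod (z $ 1))\<^sup>2) powi k * (cmod (z $ 2))\<^sup>2)"
  by (simp only: fibre_weight_of_real complex_norm_square of_real_add of_real_1 of_real_mult)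

lemma fibre_norm_nonzero [simp]: "1 + fibre_weight k z * (z $ 2 * cnj (z $ 2)) \<noteq> 0"
  unfolding fibre_norm_of_real of_real_eq_0_iff using fibre_norm_pos[of z k] by linarith

lemma base_inv_of_real: "base_inv z = of_real (1 / (1 + (cmod (z $ 1))\<^sup>2))"
  by (simp add: base_inv_def base_norm_of_real divide_inverse)

lemma fibre_inv_of_real:
  "fibre_inv k z = of_real (1 / (1 + (1 + (cmod (z $ 1))\<^sup>2) powi k * (cmod (z $ 2))\<^sup>2))"
  unfolding fibre_inv_def fibre_norm_of_real by (simp add: divide_inverse)

lemma cnj_real_factors [simp]:
  "cnj (base_inv z) = base_inv z" "cnj (fibre_weight k z) = fibre_weight k z"
  "cnj (fibre_inv k z) = fibre_inv k z"
  by (simp_all only: base_inv_of_real fibre_weight_of_real fibre_inv_of_real complex_cnj_complex_of_real)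

lemma base_inv_eq: "base_inv z + base_inv z * z $ 1 * cnj (z $ 1) = 1"
  using right_inverse[OF base_norm_nonzero[of z]]
  by (simp add: base_inv_def base_norm_def algebra_simps del: base_norm_nonzero)

text \<open>The polynomial identities for the second and fourth derivatives of the potential hold
  modulo this relation.\<close>

lemma fibre_inv_eq: "fibre_inv k z + fibre_inv k z * fibre_weight k z * z $ 2 * cnj (z $ 2) = 1"
  using right_inverse[OF fibre_norm_nonzero[of k z]]
  by (simp add: fibre_inv_def algebra_simps del: fibre_norm_nonzero)

lemma rational_factors:
  "rational_zzbar base_norm" "rational_zzbar base_inv" "rational_zzbar (fibre_weight k)"
  "rational_zzbar (fibre_inv k)" "rational_zzbar (dlog_base \<xi>)"
  "rational_zzbar (\<lambda>z. cnj (dlog_base \<xi> z))" "rational_zzbar (vertical k \<xi>)"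
  "rational_zzbar (\<lambda>z. cnj (vertical k \<xi> z))"
proof -
  note intros = rational_zzbar.intros rational_zzbar_power_int
  show b: "rational_zzbar base_norm"
    unfolding base_norm_def [abs_def] by (intro intros)
  show i: "rational_zzbar base_inv"
    unfolding base_inv_def [abs_def] by (intro intros b base_norm_nonzero)
  show w: "rational_zzbar (fibre_weight k)"
    unfolding fibre_weight_def [abs_def] by (intro intros b base_norm_nonzero)
  show "rational_zzbar (fibre_inv k)"
    unfolding fibre_inv_def [abs_def] by (intro intros w fibre_norm_nonzero)
  show d: "rational_zzbar (dlog_base \<xi>)"
    unfolding dlog_base_def [abs_def] by (intro intros i)
  show d': "rational_zzbar (\<lambda>z. cnj (dlog_base \<xi> z))"
    unfolding dlog_base_def complex_cnj_mult complex_cnj_cnj cnj_real_factors by (intro intros i)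
  show "rational_zzbar (vertical k \<xi>)"
    unfolding vertical_def [abs_def] by (intro intros d)
  show "rational_zzbar (\<lambda>z. cnj (vertical k \<xi> z))"
    unfolding vertical_def complex_cnj_mult complex_cnj_add complex_cnj_cnj complex_cnj_of_int
    by (intro intros d')
qed

lemma has_wirtinger_base_norm:
  "has_wirtinger base_norm \<xi> (base_norm z * dlog_base \<xi> z) (base_norm z * cnj (dlog_base \<xi> z)) z"
proof -
  have "has_wirtinger base_norm \<xi> (0 + (\<xi> $ 1 * cnj (z $ 1) + z $ 1 * cnj 0))
     (0 + (0 * cnj (z $ 1) + z $ 1 * cnj (\<xi> $ 1))) z"
    unfolding base_norm_def [abs_def]
    by (intro has_wirtinger_add has_wirtinger_const has_wirtinger_mult has_wirtinger_cnj
        has_wirtinger_coord)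
  then show ?thesis
    by (rule has_wirtinger_eq_rhs)
       (simp_all add: dlog_base_def, simp_all add: base_inv_def)
qed

lemma has_wirtinger_base_inv:
  "has_wirtinger base_inv \<xi> (- base_inv z * dlog_base \<xi> z) (- base_inv z * cnj (dlog_base \<xi> z)) z"
  unfolding base_inv_def [abs_def]
  by (rule has_wirtinger_eq_rhs[OF has_wirtinger_inverse[OF has_wirtinger_base_norm]])
     (simp_all add: power2_eq_square)

lemma has_wirtinger_fibre_weight:
  "has_wirtinger (fibre_weight k) \<xi> (of_int k * dlog_base \<xi> z * fibre_weight k z)
     (of_int k * cnj (dlog_base \<xi> z) * fibre_weight k z) z"
  unfolding fibre_weight_def [abs_def]
  by (rule has_wirtinger_eq_rhs[OF has_wirtinger_power_int[OF has_wirtinger_base_norm]])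
     (simp_all add: power_int_diff)

lemma has_wirtinger_dlog_base:
  "has_wirtinger (dlog_base \<eta>) \<xi> (- dlog_base \<eta> z * dlog_base \<xi> z)
     (\<eta> $ 1 * cnj (\<xi> $ 1) * (base_inv z)\<^sup>2) z"
proof -
  have "has_wirtinger (dlog_base \<eta>) \<xi>
     ((cnj 0 * base_inv z + cnj (z $ 1) * (- base_inv z * dlog_base \<xi> z)) * \<eta> $ 1 + cnj (z $ 1) * base_inv z * 0)
     ((cnj (\<xi> $ 1) * base_inv z + cnj (z $ 1) * (- base_inv z * cnj (dlog_base \<xi> z))) * \<eta> $ 1 + cnj (z $ 1) * base_inv z * 0) z"
    unfolding dlog_base_def [of \<eta>, abs_def]
    by (intro has_wirtinger_const has_wirtinger_mult has_wirtinger_cnj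
        has_wirtinger_coord has_wirtinger_base_inv)
  then show ?thesis
  proof (rule has_wirtinger_eq_rhs)
    have "cnj (\<xi> $ 1) * base_inv z + cnj (z $ 1) * (- base_inv z * cnj (dlog_base \<xi> z))
      = cnj (\<xi> $ 1) * base_inv z * (1 - base_inv z * z $ 1 * cnj (z $ 1))"
      by (simp add: dlog_base_def algebra_simps)
    also have "\<dots> = cnj (\<xi> $ 1) * (base_inv z)\<^sup>2"
      using base_inv_eq[of z] by (simp add: power2_eq_square algebra_simps flip: eq_diff_eq)
    finally show "(cnj (\<xi> $ 1) * base_inv z + cnj (z $ 1) * (- base_inv z * cnj (dlog_base \<xi> z))) * \<eta> $ 1
        + cnj (z $ 1) * base_inv z * 0 = \<eta> $ 1 * cnj (\<xi> $ 1) * (base_inv z)\<^sup>2" by simp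
  qed (simp add: dlog_base_def)
qed

lemma has_wirtinger_vertical:
  "has_wirtinger (vertical k \<eta>) \<xi>
     (of_int k * dlog_base \<eta> z * (\<xi> $ 2 - dlog_base \<xi> z * z $ 2))
     (of_int k * \<eta> $ 1 * cnj (\<xi> $ 1) * (base_inv z)\<^sup>2 * z $ 2) z"
  unfolding vertical_def [abs_def]
  by (rule has_wirtinger_eq_rhs[OF has_wirtinger_add[OF has_wirtinger_const has_wirtinger_mult[OF
     has_wirtinger_mult[OF has_wirtinger_const has_wirtinger_dlog_base] has_wirtinger_coord]]])
     (simp_all add: algebra_simps)

lemma has_wirtinger_fibre_norm:
  "has_wirtinger (\<lambda>z. 1 + fibre_weight k z * (z $ 2 * cnj (z $ 2))) \<xi>
     (fibre_weight k z * cnj (z $ 2) * vertical k \<xi> z)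
     (fibre_weight k z * z $ 2 * cnj (vertical k \<xi> z)) z"
  by (rule has_wirtinger_eq_rhs[OF has_wirtinger_add[OF has_wirtinger_const has_wirtinger_mult[OF
     has_wirtinger_fibre_weight has_wirtinger_mult[OF has_wirtinger_coord has_wirtinger_cnj[OF has_wirtinger_coord]]]]])
     (simp_all add: vertical_def algebra_simps)

lemma has_wirtinger_fibre_inv:
  "has_wirtinger (fibre_inv k) \<xi>
     (- (fibre_inv k z)\<^sup>2 * fibre_weight k z * cnj (z $ 2) * vertical k \<xi> z)
     (- (fibre_inv k z)\<^sup>2 * fibre_weight k z * z $ 2 * cnj (vertical k \<xi> z)) z"
  unfolding fibre_inv_def [abs_def]
  by (rule has_wirtinger_eq_rhs[OF has_wirtinger_inverse[OF has_wirtinger_fibre_norm]])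
     simp_all

lemma has_wirtinger_horizontal_coeff:
  "has_wirtinger (horizontal_coeff A k s) \<xi>
     (of_real s * of_int k * (fibre_inv k z)\<^sup>2 * fibre_weight k z * cnj (z $ 2) * vertical k \<xi> z)
     (of_real s * of_int k * (fibre_inv k z)\<^sup>2 * fibre_weight k z * z $ 2 * cnj (vertical k \<xi> z)) z"
  unfolding horizontal_coeff_def [abs_def]
  by (rule has_wirtinger_eq_rhs[OF has_wirtinger_add[OF has_wirtinger_const
        has_wirtinger_mult[OF has_wirtinger_const
          has_wirtinger_diff[OF has_wirtinger_const has_wirtinger_fibre_inv]]]]) simp_all

lemmas has_wirtinger_factors =
  has_wirtinger_add has_wirtinger_diff has_wirtinger_mult has_wirtinger_const has_wirtinger_coord has_wirtinger_cnj has_wirtinger_square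
  has_wirtinger_base_inv has_wirtinger_fibre_weight has_wirtinger_dlog_base has_wirtinger_vertical
  has_wirtinger_fibre_inv has_wirtinger_horizontal_coeff

section \<open>The metric and its derivatives\<close>

definition bundle_potential :: "real \<Rightarrow> int \<Rightarrow> real \<Rightarrow> complex^2 \<Rightarrow> real" where
  "bundle_potential A k s z = A * ln (1 + (cmod (z $ 1))\<^sup>2)
     + s * ln (1 + (1 + (cmod (z $ 1))\<^sup>2) powi k * (cmod (z $ 2))\<^sup>2)"

text \<open>
  The metric polarised in \<open>\<xi>\<close> and \<open>\<eta>\<close>: the horizontal and the vertical distribution are
  orthogonal, and the vertical summand is \<open>s\<close> times the Fubini-Study metric of the fibre.
\<close>

definition bundle_form :: "real \<Rightarrow> int \<Rightarrow> real \<Rightarrow> complex^2 \<Rightarrow> complex^2 \<Rightarrow> complex^2 \<Rightarrow> complex" where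
  "bundle_form A k s \<xi> \<eta> z =
     \<xi> $ 1 * cnj (\<eta> $ 1) * (base_inv z)\<^sup>2 * horizontal_coeff A k s z
     + of_real s * fibre_weight k z * (fibre_inv k z)\<^sup>2 * vertical k \<xi> z * cnj (vertical k \<eta> z)"

lemma has_wirtinger_potential:
  "has_wirtinger (\<lambda>w. complex_of_real (bundle_potential A k s w)) \<eta>
     (of_real A * dlog_base \<eta> z
       + of_real s * (fibre_inv k z * fibre_weight k z * cnj (z $ 2) * vertical k \<eta> z))
     (of_real A * cnj (dlog_base \<eta> z)
       + of_real s * (fibre_inv k z * fibre_weight k z * z $ 2 * cnj (vertical k \<eta> z))) z"
proof -
  have 1: "has_wirtinger (\<lambda>w. complex_of_real (ln (1 + (cmod (w $ 1))\<^sup>2))) \<eta>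
      (base_norm z * dlog_base \<eta> z / of_real (1 + (cmod (z $ 1))\<^sup>2))
      (base_norm z * cnj (dlog_base \<eta> z) / of_real (1 + (cmod (z $ 1))\<^sup>2)) z"
    by (intro has_wirtinger_ln base_pos)
       (use has_wirtinger_base_norm in \<open>simp add: base_norm_of_real[abs_def]\<close>)
  have 2: "has_wirtinger (\<lambda>w. complex_of_real (ln (1 + (1 + (cmod (w $ 1))\<^sup>2) powi k * (cmod (w $ 2))\<^sup>2))) \<eta>
      (fibre_weight k z * cnj (z $ 2) * vertical k \<eta> z
         / of_real (1 + (1 + (cmod (z $ 1))\<^sup>2) powi k * (cmod (z $ 2))\<^sup>2))
      (fibre_weight k z * z $ 2 * cnj (vertical k \<eta> z)
         / of_real (1 + (1 + (cmod (z $ 1))\<^sup>2) powi k * (cmod (z $ 2))\<^sup>2)) z"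
    by (intro has_wirtinger_ln fibre_norm_pos)
       (use has_wirtinger_fibre_norm in \<open>simp only: fibre_norm_of_real\<close>)
  have "(\<lambda>w. complex_of_real (bundle_potential A k s w)) =
    (\<lambda>w. of_real A * complex_of_real (ln (1 + (cmod (w $ 1))\<^sup>2))
       + of_real s * complex_of_real (ln (1 + (1 + (cmod (w $ 1))\<^sup>2) powi k * (cmod (w $ 2))\<^sup>2)))"
    by (simp add: bundle_potential_def)
  then show ?thesis
    by (simp only:) (rule has_wirtinger_eq_rhs[OF has_wirtinger_add[OF
        has_wirtinger_mult[OF has_wirtinger_const 1] has_wirtinger_mult[OF has_wirtinger_const 2]]],
      simp_all only: flip: base_norm_of_real fibre_norm_of_real,
      simp_all add: fibre_inv_def divide_inverse mult_ac)
qed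

text \<open>The difference of the two sides is an explicit multiple of the relation \<open>rel\<close>.\<close>

lemma hessian_identity:
  fixes A s k U Y S w w' x b B x' B' E :: complex
  assumes rel: "Y + Y * S * w * w' = 1" and B: "B = b + k * E * w"
  shows "A * (x' * x * U\<^sup>2) + s * ((- Y\<^sup>2 * S * w' * B) * S * w * B' + Y * k * E * S * w * B' + Y * S * b * B'
        + Y * S * w * (k * x' * x * U\<^sup>2 * w'))
     = x * x' * U\<^sup>2 * (A + s * k * (1 - Y)) + s * S * Y\<^sup>2 * B * B'" (is "?L = ?R")
proof -
  have "?L - ?R = s * (k * x' * x * U\<^sup>2 - Y * S * B * B') * (Y + Y * S * w * w' - 1)"
    unfolding B by algebra
  then show ?thesis using rel by simp
qed

lemma has_wirtinger_potential_bar: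
  "\<exists>q. has_wirtinger (\<lambda>z. of_real A * cnj (dlog_base \<eta> z)
       + of_real s * (fibre_inv k z * fibre_weight k z * z $ 2 * cnj (vertical k \<eta> z)))
     \<xi> (bundle_form A k s \<xi> \<eta> z) q z"
  apply (rule exI, rule has_wirtinger_eq_rhs, (rule has_wirtinger_factors)+)
   apply (rule trans[OF _ trans[OF hessian_identity[OF fibre_inv_eq[of k z] vertical_def[of k \<xi> z],
          of "of_real A" "cnj (\<eta> $ 1)" "\<xi> $ 1" "base_inv z" "of_real s" "cnj (vertical k \<eta> z)"]]])
    apply (simp_all add: bundle_form_def horizontal_coeff_def)
    apply (simp_all add: algebra_simps)
  done

lemma hessian_eq_bundle_form:
  "complex_hessian (bundle_potential A k s) z $ i $ j = bundle_form A k s (axis i 1) (axis j 1) z"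
proof -
  have "wirtinger_bar j (\<lambda>w. complex_of_real (bundle_potential A k s w)) =
    (\<lambda>z. of_real A * cnj (dlog_base (axis j 1) z)
       + of_real s * (fibre_inv k z * fibre_weight k z * z $ 2 * cnj (vertical k (axis j 1) z)))"
    using has_wirtinger_axis(2)[OF has_wirtinger_potential] by blast
  moreover obtain q where "has_wirtinger (\<lambda>z. of_real A * cnj (dlog_base (axis j 1) z)
       + of_real s * (fibre_inv k z * fibre_weight k z * z $ 2 * cnj (vertical k (axis j 1) z)))
     (axis i 1) (bundle_form A k s (axis i 1) (axis j 1) z) q z"
    using has_wirtinger_potential_bar by blast
  ultimately show ?thesis
    using has_wirtinger_axis(1) by (simp add: complex_hessian_def)
qed

lemma rational_bundle_form: "rational_zzbar (bundle_form A k s \<xi> \<eta>)"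
  unfolding bundle_form_def [abs_def] horizontal_coeff_def power2_eq_square
  by (intro rational_zzbar.intros(1-5) rational_zzbar_diff rational_factors)

text \<open>
  Differentiating the covector dual to the constant field \<open>\<xi>\<close> along \<open>\<xi>\<close> gives again a combination
  of the horizontal and the vertical coframe; the next two functions are its components.
\<close>

definition horizontal_deriv :: "real \<Rightarrow> int \<Rightarrow> real \<Rightarrow> complex^2 \<Rightarrow> complex^2 \<Rightarrow> complex" where
  "horizontal_deriv A k s \<xi> z =
     - 2 * dlog_base \<xi> z * horizontal_coeff A k s z
     + 2 * of_real s * of_int k * (fibre_inv k z)\<^sup>2 * fibre_weight k z * cnj (z $ 2) * vertical k \<xi> z"

definition vertical_deriv :: "int \<Rightarrow> complex^2 \<Rightarrow> complex^2 \<Rightarrow> complex" where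
  "vertical_deriv k \<xi> z =
     of_int k * dlog_base \<xi> z * (vertical k \<xi> z + \<xi> $ 2 - dlog_base \<xi> z * z $ 2)
     - 2 * fibre_inv k z * fibre_weight k z * cnj (z $ 2) * (vertical k \<xi> z)\<^sup>2"

definition form_deriv ::
  "real \<Rightarrow> int \<Rightarrow> real \<Rightarrow> complex^2 \<Rightarrow> complex^2 \<Rightarrow> complex^2 \<Rightarrow> complex" where
  "form_deriv A k s \<xi> \<eta> z =
     \<xi> $ 1 * cnj (\<eta> $ 1) * (base_inv z)\<^sup>2 * horizontal_deriv A k s \<xi> z
     + of_real s * fibre_weight k z * (fibre_inv k z)\<^sup>2 * cnj (vertical k \<eta> z) * vertical_deriv k \<xi> z"

lemma cnj_bundle_form: "cnj (bundle_form A k s \<xi> \<eta> z) = bundle_form A k s \<eta> \<xi> z"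
  by (simp add: bundle_form_def horizontal_coeff_def)

lemma has_wirtinger_bundle_form:
  "\<exists>q. has_wirtinger (bundle_form A k s \<xi> \<eta>) \<xi> (form_deriv A k s \<xi> \<eta> z) q z"
  unfolding bundle_form_def [abs_def]
  apply (rule exI, rule has_wirtinger_eq_rhs, (rule has_wirtinger_factors)+)
   apply (simp add: form_deriv_def horizontal_deriv_def vertical_deriv_def)
   apply (simp add: algebra_simps power2_eq_square)
  apply (rule refl)
  done

text \<open>
  The left side is the expression that the product rule produces for the second derivative of the
  squared length of \<open>\<xi>\<close>.  On the right, the terms free of \<open>E\<close>, \<open>w\<close> and \<open>CC\<close> are covariant; the
  others depend on the coordinates and cancel later against the square of the first derivative, whose
  vertical part is \<open>CC\<close>.  The difference of the sides is an explicit multiple of the relation \<open>rel\<close>.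
\<close>

lemma curvature_identity:
  fixes s k h E E' S Y w w' b b' B B' al M CC :: complex
  assumes rel: "Y + Y * S * w * w' = 1" and B: "B = b + k * E * w" "B' = b' + k * E' * w'"
    and M: "M = S * B * B'"
  shows "- 2 * E' * h * (- 2 * E * al + 2 * s * k * Y\<^sup>2 * S * w' * B)
    + h * (- 2 * h * al - 2 * E * s * k * Y\<^sup>2 * S * w * B'
       + 2 * s * k * (- 2 * Y * Y\<^sup>2 * S * w * B' * S * w' * B + Y\<^sup>2 * k * E' * S * w' * B
          + Y\<^sup>2 * S * b' * B + Y\<^sup>2 * S * w' * k * h * w))
    + s * S * Y\<^sup>2 * B' * (k * h * (B + b - E * w) + k * E * (k * h * w - h * w)
       - 2 * (- Y\<^sup>2 * S * w * B' * S * w' * B\<^sup>2 + Y * k * E' * S * w' * B\<^sup>2 + Y * S * b' * B\<^sup>2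
          + 2 * Y * S * w' * B * k * h * w))
    + CC
    = - 2 * h\<^sup>2 * (al - s * k\<^sup>2 * (1 - Y) * Y) + 4 * h * M * Y\<^sup>2 * s * k * (2 * Y - 1)
      - 2 * s * M\<^sup>2 * Y ^ 4 + 4 * E * E' * h * al - 4 * h * s * k * Y\<^sup>2 * S * (E * w * B' + E' * w' * B)
      + CC" (is "?L = ?R")
proof -
  have "?L - ?R = (2 * s * k\<^sup>2 * h\<^sup>2 * Y - 8 * s * k * h * Y\<^sup>2 * M + 2 * s * Y ^ 3 * M\<^sup>2)
     * (Y + Y * S * w * w' - 1)"
    unfolding M using B by algebra
  then show ?thesis using rel by simp
qed

lemma has_wirtinger_form_deriv:
  fixes A k s \<xi> z
  defines "h \<equiv> \<xi> $ 1 * cnj (\<xi> $ 1) * (base_inv z)\<^sup>2" and "S \<equiv> fibre_weight k z" and "Y \<equiv> fibre_inv k z"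
    and "E \<equiv> dlog_base \<xi> z" and "B \<equiv> vertical k \<xi> z" and "al \<equiv> horizontal_coeff A k s z"
  defines "M \<equiv> S * B * cnj B" and "C \<equiv> vertical_deriv k \<xi> z"
  shows "\<exists>p. has_wirtinger (form_deriv A k s \<xi> \<xi>) \<xi> p
    (- 2 * h\<^sup>2 * (al - of_real s * (of_int k)\<^sup>2 * (1 - Y) * Y) + 4 * h * M * Y\<^sup>2 * of_real s * of_int k * (2 * Y - 1)
      - 2 * of_real s * M\<^sup>2 * Y ^ 4 + 4 * E * cnj E * h * al
      - 4 * h * of_real s * of_int k * Y\<^sup>2 * S * (E * z $ 2 * cnj B + cnj E * cnj (z $ 2) * B)
      + of_real s * S * Y\<^sup>2 * C * cnj C) z"
proof -
  have C': "cnj C = of_int k * cnj E * (cnj B + cnj (\<xi> $ 2) - cnj E * cnj (z $ 2)) - 2 * Y * S * z $ 2 * (cnj B)\<^sup>2"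
    and C: "C = of_int k * E * (B + \<xi> $ 2 - E * z $ 2) - 2 * Y * S * cnj (z $ 2) * B\<^sup>2"
    by (simp_all add: C_def vertical_deriv_def E_def B_def Y_def S_def)
  have "vertical k \<xi> z = \<xi> $ 2 + of_int k * dlog_base \<xi> z * z $ 2"
    "cnj (vertical k \<xi> z) = cnj (\<xi> $ 2) + of_int k * cnj (dlog_base \<xi> z) * cnj (z $ 2)"
    by (simp_all add: vertical_def)
  note id = curvature_identity[OF fibre_inv_eq[of k z] this refl,
     where s = "of_real s" and h = h]
  show ?thesis
    unfolding form_deriv_def [abs_def] horizontal_deriv_def vertical_deriv_def
    apply (rule exI, rule has_wirtinger_eq_rhs, (rule has_wirtinger_factors)+)
     apply (rule refl)
    unfolding Y_def S_def E_def B_def M_def al_def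
    apply (rule trans[OF _ id])
    apply (simp add: horizontal_coeff_def C' Y_def S_def E_def B_def h_def)
    apply (simp add: C Y_def S_def E_def B_def h_def)
    apply (simp add: algebra_simps power2_eq_square)
    done
qed

section \<open>The curvature of the bundle metrics\<close>

lemma bundle_form_sesquilinear:
  "(\<Sum>i\<in>UNIV. \<xi> $ i * bundle_form A k s (axis i 1) \<eta> z) = bundle_form A k s \<xi> \<eta> z"
  "(\<Sum>j\<in>UNIV. cnj (\<eta> $ j) * bundle_form A k s \<xi> (axis j 1) z) = bundle_form A k s \<xi> \<eta> z"
  by (simp_all add: sum_2 bundle_form_def vertical_def dlog_base_def axis_def algebra_simps)

lemma hessian_quadratic_form:
  "(\<Sum>i\<in>UNIV. \<Sum>j\<in>UNIV. complex_hessian (bundle_potential A k s) z $ i $ j * \<xi> $ i * cnj (\<xi> $ j))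
     = bundle_form A k s \<xi> \<xi> z"
proof -
  have "(\<Sum>i\<in>UNIV. \<Sum>j\<in>UNIV. complex_hessian (bundle_potential A k s) z $ i $ j * \<xi> $ i * cnj (\<xi> $ j))
    = (\<Sum>i\<in>UNIV. \<xi> $ i * (\<Sum>j\<in>UNIV. cnj (\<xi> $ j) * bundle_form A k s (axis i 1) (axis j 1) z))"
    by (simp add: hessian_eq_bundle_form sum_distrib_left mult_ac)
  then show ?thesis by (simp add: bundle_form_sesquilinear)
qed

text \<open>
  Completing the square: the vector \<open>(1, - x)\<close> is orthogonal to the second coordinate
  vector, their squared lengths are \<open>lam\<close> and \<open>mu\<close>, and the inverse matrix pairs covectors through
  this orthogonal frame.
\<close>

lemma matrix_inv_hermitian_2:
  fixes G :: "complex^2^2" and c d :: "2 \<Rightarrow> complex"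
  assumes "lam \<noteq> 0" "mu \<noteq> 0"
    and G: "G $ 1 $ 1 = lam + mu * x * x'" "G $ 1 $ 2 = mu * x" "G $ 2 $ 1 = mu * x'" "G $ 2 $ 2 = mu"
  shows "(\<Sum>p\<in>UNIV. \<Sum>q\<in>UNIV. matrix_inv G $ p $ q * c p * d q)
     = (c 1 - x' * c 2) * (d 1 - x * d 2) / lam + c 2 * d 2 / mu"
proof -
  define H :: "complex^2^2" where
    "H = vector [vector [1 / lam, - x / lam], vector [- x' / lam, 1 / mu + x * x' / lam]]"
  have "G ** H = mat 1" "H ** G = mat 1"
    using assms(1,2) by (simp_all add: vec_eq_iff forall_2 matrix_matrix_mult_def sum_2 G H_def mat_def field_simps)
  then have "matrix_inv G = H"
    unfolding matrix_inv_def
    by (intro some_equality) (auto, metis matrix_mul_assoc matrix_mul_lid matrix_mul_rid)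
  then show ?thesis
    using assms(1,2) by (simp add: sum_2 H_def field_simps)
qed

text \<open>
  Adding the square of the first derivative removes all terms that depend on the choice of
  coordinates and leaves a quadratic form in the squared lengths \<open>h\<close> and \<open>M\<close> of the base and the
  fibre component.  Its vanishing odd terms reflect the circle of isometries that fix a point and rotate
  the base.
\<close>

lemma curvature_sum_identity:
  fixes s k h E E' S Y w w' B B' al M CC :: complex
  assumes rel: "Y + Y * S * w * w' = 1" and al: "al \<noteq> 0" and M: "M = S * B * B'"
  shows "- (- 2 * h\<^sup>2 * (al - s * k\<^sup>2 * (1 - Y) * Y) + 4 * h * M * Y\<^sup>2 * s * k * (2 * Y - 1)
      - 2 * s * M\<^sup>2 * Y ^ 4 + 4 * E * E' * h * al - 4 * h * s * k * Y\<^sup>2 * S * (E * w * B' + E' * w' * B)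
      + CC)
    + (h * ((- 2 * E * al + 2 * s * k * Y\<^sup>2 * S * w' * B) * (- 2 * E' * al + 2 * s * k * Y\<^sup>2 * S * w * B')) / al + CC)
    = 2 * h\<^sup>2 * (al - s * k\<^sup>2 * (1 - Y) * Y)
      + 4 * h * M * Y\<^sup>2 * (s\<^sup>2 * k\<^sup>2 * (1 - Y) * Y / al - s * k * (2 * Y - 1)) + 2 * s * M\<^sup>2 * Y ^ 4"
    (is "?L = ?R")
proof -
  have y: "Y * S * w * w' = 1 - Y" using rel by (simp add: algebra_simps)
  have "h * ((- 2 * E * al + 2 * s * k * Y\<^sup>2 * S * w' * B) * (- 2 * E' * al + 2 * s * k * Y\<^sup>2 * S * w * B'))
     = al * (4 * E * E' * h * al - 4 * h * s * k * Y\<^sup>2 * S * (E * w * B' + E' * w' * B))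
       + 4 * h * s\<^sup>2 * k\<^sup>2 * Y ^ 3 * (Y * S * w * w') * M"
    unfolding M by algebra
  also have "\<dots> / al = 4 * E * E' * h * al - 4 * h * s * k * Y\<^sup>2 * S * (E * w * B' + E' * w' * B)
      + 4 * h * M * Y\<^sup>2 * (s\<^sup>2 * k\<^sup>2 * (1 - Y) * Y / al)"
    unfolding y using al by (simp add: add_divide_distrib power2_eq_square power3_eq_cube mult_ac)
  finally show ?thesis by (simp add: algebra_simps)
qed

text \<open>The coefficient is a convex combination of \<open>A\<close> and \<open>A + s k\<close>.\<close>

lemma horizontal_coeff_nonzero:
  assumes "A > 0" "A + s * of_int k > 0"
  shows "horizontal_coeff A k s z \<noteq> 0"
proof -
  define Y where "Y = 1 / (1 + (1 + (cmod (z $ 1))\<^sup>2) powi k * (cmod (z $ 2))\<^sup>2)"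
  have Y: "0 < Y" "Y \<le> 1"
    using fibre_norm_pos[of z k] base_pos[of z] unfolding Y_def by (auto simp: divide_simps)
  have "A + s * of_int k * (1 - Y) = A * Y + (A + s * of_int k) * (1 - Y)" by (simp add: algebra_simps)
  also have "\<dots> > 0" using Y assms by (intro add_pos_nonneg) auto
  finally have "A + s * of_int k * (1 - Y) \<noteq> 0" by simp
  moreover have "horizontal_coeff A k s z = of_real (A + s * of_int k * (1 - Y))"
    by (simp add: horizontal_coeff_def fibre_inv_of_real Y_def)
  ultimately show ?thesis by (metis of_real_eq_0_iff)
qed

lemma bundle_curvature:
  fixes A s :: real and k :: int and \<xi> z :: "complex^2" and h Y al M :: complex
  defines "h \<equiv> \<xi> $ 1 * cnj (\<xi> $ 1) * (base_inv z)\<^sup>2" and "Y \<equiv> fibre_inv k z"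
    and "al \<equiv> horizontal_coeff A k s z"
    and "M \<equiv> fibre_weight k z * vertical k \<xi> z * cnj (vertical k \<xi> z)"
    and "g \<equiv> complex_hessian (bundle_potential A k s)"
  assumes pos: "A > 0" "A + s * of_int k > 0" "s > 0"
  shows "(\<Sum>i\<in>UNIV. \<Sum>j\<in>UNIV. \<Sum>k\<in>UNIV. \<Sum>l\<in>UNIV.
            curvature g z i j k l * \<xi> $ i * cnj (\<xi> $ j) * \<xi> $ k * cnj (\<xi> $ l))
       = 2 * h\<^sup>2 * (al - of_real s * (of_int k)\<^sup>2 * (1 - Y) * Y)
      + 4 * h * M * Y\<^sup>2 * ((of_real s)\<^sup>2 * (of_int k)\<^sup>2 * (1 - Y) * Y / al - of_real s * of_int k * (2 * Y - 1))
      + 2 * of_real s * M\<^sup>2 * Y ^ 4"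
proof -
  have gij: "g w $ i $ j = bundle_form A k s (axis i 1) (axis j 1) w" for w i j
    by (simp add: g_def hessian_eq_bundle_form)
  have N: "(\<Sum>i\<in>UNIV. \<Sum>j\<in>UNIV. g w $ i $ j * \<xi> $ i * cnj (\<xi> $ j)) = bundle_form A k s \<xi> \<xi> w" for w
    unfolding g_def by (rule hessian_quadratic_form)
  have ex: "\<exists>p. has_wirtinger (bundle_form A k s \<eta> \<xi>) \<xi> p (cnj (form_deriv A k s \<xi> \<eta> w)) w" for \<eta> w
  proof -
    obtain q' where "has_wirtinger (bundle_form A k s \<xi> \<eta>) \<xi> (form_deriv A k s \<xi> \<eta> w) q' w"
      using has_wirtinger_bundle_form by blast
    from has_wirtinger_cnj[OF this] show ?thesis
      by (auto simp: cnj_bundle_form)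
  qed
  have ex': "\<exists>q. has_wirtinger (bundle_form A k s \<xi> \<eta>) \<xi> (form_deriv A k s \<xi> \<eta> w) q w" for \<eta> w
    using has_wirtinger_bundle_form by blast
  let ?E = "dlog_base \<xi> z" and ?B = "vertical k \<xi> z" and ?C = "vertical_deriv k \<xi> z"
  define S where "S = fibre_weight k z"
  define X where "X = - 2 * h\<^sup>2 * (al - of_real s * (of_int k)\<^sup>2 * (1 - Y) * Y) + 4 * h * M * Y\<^sup>2 * of_real s * of_int k * (2 * Y - 1)
      - 2 * of_real s * M\<^sup>2 * Y ^ 4 + 4 * ?E * cnj ?E * h * al
      - 4 * h * of_real s * of_int k * Y\<^sup>2 * S * (?E * z $ 2 * cnj ?B + cnj ?E * cnj (z $ 2) * ?B)
      + of_real s * S * Y\<^sup>2 * ?C * cnj ?C"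
  have X: "\<exists>p. has_wirtinger (form_deriv A k s \<xi> \<xi>) \<xi> p X z"
    using has_wirtinger_form_deriv[of A k s \<xi> z] unfolding X_def h_def al_def Y_def M_def S_def .
  have cnjX: "cnj X = X"
    by (simp add: X_def h_def Y_def al_def horizontal_coeff_def M_def S_def algebra_simps)
  obtain N1 where N1: "\<And>w. has_wirtinger (bundle_form A k s \<xi> \<xi>) \<xi> (N1 w) (cnj (form_deriv A k s \<xi> \<xi> w)) w"
    using ex[of \<xi>] by metis
  obtain x where x: "has_wirtinger (\<lambda>w. cnj (form_deriv A k s \<xi> \<xi> w)) \<xi> X x z"
    using X has_wirtinger_cnj cnjX by metis
  obtain c' where c': "\<And>p. has_wirtinger (bundle_form A k s \<xi> (axis p 1)) \<xi>
      (form_deriv A k s \<xi> (axis p 1) z) (c' p) z"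
    using ex'[of "axis _ 1" z] by metis
  obtain d' where d': "\<And>q. has_wirtinger (bundle_form A k s (axis q 1) \<xi>) \<xi> (d' q)
      (cnj (form_deriv A k s \<xi> (axis q 1) z)) z"
    using ex[of "axis _ 1" z] by metis
  have "(\<Sum>i\<in>UNIV. \<Sum>j\<in>UNIV. \<Sum>k\<in>UNIV. \<Sum>l\<in>UNIV.
            curvature g z i j k l * \<xi> $ i * cnj (\<xi> $ j) * \<xi> $ k * cnj (\<xi> $ l))
     = - X + (\<Sum>p\<in>UNIV. \<Sum>q\<in>UNIV. matrix_inv (g z) $ p $ q * form_deriv A k s \<xi> (axis p 1) z
           * cnj (form_deriv A k s \<xi> (axis q 1) z))"
  proof (rule curvature_quartic)
    show "rational_zzbar (\<lambda>w. g w $ i $ j)" for i j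
      unfolding gij by (rule rational_bundle_form)
    show "has_wirtinger (\<lambda>w. \<Sum>i\<in>UNIV. \<Sum>j\<in>UNIV. g w $ i $ j * \<xi> $ i * cnj (\<xi> $ j)) \<xi>
        (N1 w) (cnj (form_deriv A k s \<xi> \<xi> w)) w" for w
      unfolding N by (rule N1)
    show "has_wirtinger (\<lambda>w. cnj (form_deriv A k s \<xi> \<xi> w)) \<xi> X x z" by (rule x)
    show "has_wirtinger (\<lambda>w. \<Sum>i\<in>UNIV. \<xi> $ i * g w $ i $ p) \<xi> (form_deriv A k s \<xi> (axis p 1) z) (c' p) z" for p
      unfolding gij bundle_form_sesquilinear by (rule c')
    show "has_wirtinger (\<lambda>w. \<Sum>j\<in>UNIV. cnj (\<xi> $ j) * g w $ q $ j) \<xi> (d' q) (cnj (form_deriv A k s \<xi> (axis q 1) z)) z" for q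
      unfolding gij bundle_form_sesquilinear by (rule d')
  qed
  also have "(\<Sum>p\<in>UNIV. \<Sum>q\<in>UNIV. matrix_inv (g z) $ p $ q * form_deriv A k s \<xi> (axis p 1) z
           * cnj (form_deriv A k s \<xi> (axis q 1) z))
     = h * (horizontal_deriv A k s \<xi> z * cnj (horizontal_deriv A k s \<xi> z)) / al + of_real s * S * Y\<^sup>2 * ?C * cnj ?C"
  proof -
    let ?v = "vertical k (axis 1 1) z"
    have nz: "base_inv z \<noteq> 0" "Y \<noteq> 0" "S \<noteq> 0" "al \<noteq> 0" "s \<noteq> 0"
      using pos horizontal_coeff_nonzero[OF pos(1,2)] fibre_norm_nonzero[of k z]
      by (simp_all add: base_inv_def Y_def fibre_inv_def S_def fibre_weight_def al_def)
    define lam where "lam = (base_inv z)\<^sup>2 * al"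
    define mu where "mu = of_real s * S * Y\<^sup>2"
    have ax: "axis (1::2) (1::complex) $ 1 = 1" "axis (2::2) (1::complex) $ 1 = 0"
      by (simp_all add: axis_def)
    have v2: "vertical k (axis 2 1) z = 1" by (simp add: vertical_def dlog_base_def axis_def)
    have "(\<Sum>p\<in>UNIV. \<Sum>q\<in>UNIV. matrix_inv (g z) $ p $ q * form_deriv A k s \<xi> (axis p 1) z
           * cnj (form_deriv A k s \<xi> (axis q 1) z))
      = (form_deriv A k s \<xi> (axis 1 1) z - cnj ?v * form_deriv A k s \<xi> (axis 2 1) z)
         * (cnj (form_deriv A k s \<xi> (axis 1 1) z) - ?v * cnj (form_deriv A k s \<xi> (axis 2 1) z)) / lam
        + form_deriv A k s \<xi> (axis 2 1) z * cnj (form_deriv A k s \<xi> (axis 2 1) z) / mu"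
      by (rule matrix_inv_hermitian_2)
         (use nz in \<open>simp_all add: gij bundle_form_def v2 lam_def mu_def al_def S_def Y_def ax\<close>)
    also have "form_deriv A k s \<xi> (axis 2 1) z = mu * ?C"
      by (simp add: form_deriv_def v2 mu_def S_def Y_def ax)
    also have "form_deriv A k s \<xi> (axis 1 1) z = \<xi> $ 1 * (base_inv z)\<^sup>2 * horizontal_deriv A k s \<xi> z + mu * cnj ?v * ?C"
      by (simp add: form_deriv_def mu_def S_def Y_def ax)
    finally show ?thesis
      using nz by (simp add: lam_def mu_def h_def S_def Y_def power2_eq_square)
  qed
  also have "horizontal_deriv A k s \<xi> z = - 2 * ?E * al + 2 * of_real s * of_int k * Y\<^sup>2 * S * cnj (z $ 2) * ?B"
    by (simp add: horizontal_deriv_def al_def horizontal_coeff_def Y_def S_def)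
  also have "cnj (- 2 * ?E * al + 2 * of_real s * of_int k * Y\<^sup>2 * S * cnj (z $ 2) * ?B) =
      - 2 * cnj ?E * al + 2 * of_real s * of_int k * Y\<^sup>2 * S * z $ 2 * cnj ?B"
    by (simp add: al_def horizontal_coeff_def Y_def S_def)
  finally show ?thesis
    unfolding X_def
    using curvature_sum_identity[OF fibre_inv_eq[of k z] horizontal_coeff_nonzero[OF pos(1,2)] refl]
    by (simp add: al_def Y_def S_def M_def)
qed

lemma bundle_hsc:
  fixes A s :: real and k :: int and \<xi> z :: "complex^2" and h Y al M :: real
  defines "h \<equiv> (cmod (\<xi> $ 1))\<^sup>2 / (1 + (cmod (z $ 1))\<^sup>2)\<^sup>2"
    and "Y \<equiv> 1 / (1 + (1 + (cmod (z $ 1))\<^sup>2) powi k * (cmod (z $ 2))\<^sup>2)"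
    and "M \<equiv> (1 + (cmod (z $ 1))\<^sup>2) powi k * (cmod (vertical k \<xi> z))\<^sup>2"
  defines "al \<equiv> A + s * of_int k * (1 - Y)"
  assumes pos: "A > 0" "A + s * of_int k > 0" "s > 0"
  shows "hol_sect_curv (complex_hessian (bundle_potential A k s)) z \<xi> =
     2 * (2 * h\<^sup>2 * (al - s * (of_int k)\<^sup>2 * (1 - Y) * Y)
      + 4 * h * M * Y\<^sup>2 * (s\<^sup>2 * (of_int k)\<^sup>2 * (1 - Y) * Y / al - s * of_int k * (2 * Y - 1))
      + 2 * s * M\<^sup>2 * Y ^ 4) / (h * al + s * M * Y\<^sup>2)\<^sup>2"
proof -
  let ?g = "complex_hessian (bundle_potential A k s)"
  have h: "\<xi> $ 1 * cnj (\<xi> $ 1) * (base_inv z)\<^sup>2 = of_real h"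
    unfolding h_def base_inv_of_real
    by (simp only: complex_norm_square[symmetric] of_real_mult[symmetric] of_real_power[symmetric])
       (simp add: power_divide)
  have Y: "fibre_inv k z = of_real Y" unfolding Y_def by (rule fibre_inv_of_real)
  have M: "fibre_weight k z * vertical k \<xi> z * cnj (vertical k \<xi> z) = of_real M"
    unfolding M_def fibre_weight_of_real
    by (simp only: mult.assoc complex_norm_square[symmetric] of_real_mult[symmetric])
  have al: "horizontal_coeff A k s z = of_real al"
    by (simp add: horizontal_coeff_def Y al_def)
  have num: "(\<Sum>i\<in>UNIV. \<Sum>j\<in>UNIV. \<Sum>k\<in>UNIV. \<Sum>l\<in>UNIV.
            curvature ?g z i j k l * \<xi> $ i * cnj (\<xi> $ j) * \<xi> $ k * cnj (\<xi> $ l))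
     = of_real (2 * h\<^sup>2 * (al - s * (of_int k)\<^sup>2 * (1 - Y) * Y)
      + 4 * h * M * Y\<^sup>2 * (s\<^sup>2 * (of_int k)\<^sup>2 * (1 - Y) * Y / al - s * of_int k * (2 * Y - 1))
      + 2 * s * M\<^sup>2 * Y ^ 4)"
    unfolding bundle_curvature[OF pos] h Y M al by simp
  have N: "(\<Sum>i\<in>UNIV. \<Sum>j\<in>UNIV. ?g z $ i $ j * \<xi> $ i * cnj (\<xi> $ j)) = of_real (h * al + s * M * Y\<^sup>2)"
  proof -
    have "(\<Sum>i\<in>UNIV. \<Sum>j\<in>UNIV. ?g z $ i $ j * \<xi> $ i * cnj (\<xi> $ j)) = \<xi> $ 1 * cnj (\<xi> $ 1) * (base_inv z)\<^sup>2 * horizontal_coeff A k s z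
       + of_real s * (fibre_weight k z * vertical k \<xi> z * cnj (vertical k \<xi> z)) * (fibre_inv k z)\<^sup>2"
      unfolding hessian_quadratic_form by (simp add: bundle_form_def)
    also have "\<dots> = of_real (h * al + s * M * Y\<^sup>2)" unfolding h Y M al by simp
    finally show ?thesis .
  qed
  have "(\<Sum>i\<in>UNIV. \<Sum>j\<in>UNIV. \<Sum>k\<in>UNIV. \<Sum>l\<in>UNIV.
       ?g z $ i $ j * ?g z $ k $ l * \<xi> $ i * cnj (\<xi> $ j) * \<xi> $ k * cnj (\<xi> $ l))
     = (\<Sum>i\<in>UNIV. \<Sum>j\<in>UNIV. ?g z $ i $ j * \<xi> $ i * cnj (\<xi> $ j))\<^sup>2"
    by (simp add: power2_eq_square sum_2 algebra_simps)
  also have "\<dots> = of_real ((h * al + s * M * Y\<^sup>2)\<^sup>2)" unfolding N by simp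
  finally have den: "(\<Sum>i\<in>UNIV. \<Sum>j\<in>UNIV. \<Sum>k\<in>UNIV. \<Sum>l\<in>UNIV.
       ?g z $ i $ j * ?g z $ k $ l * \<xi> $ i * cnj (\<xi> $ j) * \<xi> $ k * cnj (\<xi> $ l))
     = of_real ((h * al + s * M * Y\<^sup>2)\<^sup>2)" .
  have re: "Re (2 * complex_of_real x / complex_of_real y) = 2 * x / y" for x y
    by (metis Re_complex_of_real of_real_divide of_real_mult of_real_numeral)
  show ?thesis
    unfolding hol_sect_curv_def num den by (rule re)
qed

text \<open>
  In terms of the squared lengths \<open>X\<close> and \<open>V\<close> of the horizontal and vertical components, the
  curvature at a point is the quotient of a quadratic form by \<open>(X + V)\<^sup>2\<close>.  The point enters only
  through \<open>Y\<close>, because the general orbits of the isometry group are real hypersurfaces.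
\<close>

lemma bundle_hsc_normalised:
  fixes A s :: real and k :: int and \<xi> z :: "complex^2"
  assumes pos: "A > 0" "A + s * of_int k > 0" "s > 0" and \<xi>: "\<xi> \<noteq> 0"
  obtains Y al X V where "0 \<le> Y" "Y \<le> 1" "al = A + s * of_int k * (1 - Y)" "X \<ge> 0" "V \<ge> 0" "X + V > 0"
    "hol_sect_curv (complex_hessian (bundle_potential A k s)) z \<xi> =
       4 * ((1 / al - s * (of_int k)\<^sup>2 * Y * (1 - Y) / al\<^sup>2) * X\<^sup>2
          + 2 * (s * (of_int k)\<^sup>2 * Y * (1 - Y) / al\<^sup>2 - of_int k * (2 * Y - 1) / al) * X * V
          + V\<^sup>2 / s) / (X + V)\<^sup>2"
proof -
  define Y where "Y = 1 / (1 + (1 + (cmod (z $ 1))\<^sup>2) powi k * (cmod (z $ 2))\<^sup>2)"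
  define h where "h = (cmod (\<xi> $ 1))\<^sup>2 / (1 + (cmod (z $ 1))\<^sup>2)\<^sup>2"
  define M where "M = (1 + (cmod (z $ 1))\<^sup>2) powi k * (cmod (vertical k \<xi> z))\<^sup>2"
  define al where "al = A + s * of_int k * (1 - Y)"
  note u = base_pos[of z]
  have Y: "0 < Y" "Y \<le> 1"
    using fibre_norm_pos[of z k] u unfolding Y_def by (auto simp: divide_simps)
  have "al = A * Y + (A + s * of_int k) * (1 - Y)" by (simp add: al_def algebra_simps)
  also have "\<dots> > 0" using Y pos by (intro add_pos_nonneg) auto
  finally have al: "al > 0" .
  have h: "h \<ge> 0" unfolding h_def by simp
  have M: "M \<ge> 0" unfolding M_def using u by simp
  have hM: "h > 0 \<or> M > 0"
  proof (cases "\<xi> $ 1 = 0")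
    case True
    then have "vertical k \<xi> z \<noteq> 0" using \<xi> by (auto simp: vertical_def dlog_base_def vec2_eq_iff)
    then show ?thesis unfolding M_def using u by simp
  next
    case False
    then show ?thesis unfolding h_def using u by simp
  qed
  define X where "X = h * al"
  define V where "V = s * M * Y\<^sup>2"
  have XV: "X \<ge> 0" "V \<ge> 0" using h M al pos Y by (simp_all add: X_def V_def)
  moreover have "X > 0 \<or> V > 0" using hM al pos Y by (auto simp: X_def V_def)
  ultimately have sum: "X + V > 0" by auto
  have hX: "h = X / al" and MV: "M * Y\<^sup>2 = V / s" using al pos by (simp_all add: X_def V_def)
  have "hol_sect_curv (complex_hessian (bundle_potential A k s)) z \<xi> =
     2 * (2 * h\<^sup>2 * (al - s * (of_int k)\<^sup>2 * (1 - Y) * Y)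
      + 4 * h * M * Y\<^sup>2 * (s\<^sup>2 * (of_int k)\<^sup>2 * (1 - Y) * Y / al - s * of_int k * (2 * Y - 1))
      + 2 * s * M\<^sup>2 * Y ^ 4) / (h * al + s * M * Y\<^sup>2)\<^sup>2"
    unfolding Y_def h_def M_def al_def by (rule bundle_hsc[OF pos])
  also have "\<dots> = 2 * (2 * h\<^sup>2 * (al - s * (of_int k)\<^sup>2 * (1 - Y) * Y)
      + 4 * h * (M * Y\<^sup>2) * (s\<^sup>2 * (of_int k)\<^sup>2 * (1 - Y) * Y / al - s * of_int k * (2 * Y - 1))
      + 2 * s * (M * Y\<^sup>2)\<^sup>2) / (X + V)\<^sup>2"
    by (simp add: X_def V_def power_mult_distrib mult.assoc)
  also have "2 * (2 * h\<^sup>2 * (al - s * (of_int k)\<^sup>2 * (1 - Y) * Y)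
      + 4 * h * (M * Y\<^sup>2) * (s\<^sup>2 * (of_int k)\<^sup>2 * (1 - Y) * Y / al - s * of_int k * (2 * Y - 1))
      + 2 * s * (M * Y\<^sup>2)\<^sup>2) = 4 * ((1 / al - s * (of_int k)\<^sup>2 * Y * (1 - Y) / al\<^sup>2) * X\<^sup>2
          + 2 * (s * (of_int k)\<^sup>2 * Y * (1 - Y) / al\<^sup>2 - of_int k * (2 * Y - 1) / al) * X * V
          + V\<^sup>2 / s)"
    unfolding hX MV using al pos(3) by (simp add: field_simps power2_eq_square)
  finally show ?thesis
    using that[of Y al X V] Y XV sum al_def by simp
qed

section \<open>Hirzebruch surfaces\<close>

text \<open>
  The charts \<open>FibInf\<close> are centred at one of the two distinguished sections and \<open>Fib0\<close> at the
  other, whose normal bundles are dual to each other: this is the sign change of the exponent.  Since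
  \<open>u\<^sup>n + t = u\<^sup>n (1 + u\<^sup>-\<^sup>n t)\<close>, taking logarithms moves \<open>s n\<close> copies of \<open>ln u\<close> to the first summand.
\<close>

lemma potential_eq_bundle_potential:
  "potential n s (a, FibInf) = bundle_potential 1 (int n) s"
  "potential n s (a, Fib0) = bundle_potential (1 + s * real n) (- int n) s"
proof -
  show "potential n s (a, FibInf) = bundle_potential 1 (int n) s"
    by (rule ext) (simp add: bundle_potential_def add.commute)
  show "potential n s (a, Fib0) = bundle_potential (1 + s * real n) (- int n) s"
  proof
    fix z :: "complex^2"
    let ?u = "1 + (cmod (z $ 1))\<^sup>2" and ?t = "(cmod (z $ 2))\<^sup>2"
    have u: "?u > 0" by (rule base_pos)
    have "?u ^ n + ?t = ?u ^ n * (1 + ?u powi (- int n) * ?t)"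
      using u by (simp add: power_int_minus ring_distribs)
    moreover have "1 + ?u powi (- int n) * ?t > 0" by (rule fibre_norm_pos)
    ultimately have "ln (?u ^ n + ?t) = real n * ln ?u + ln (1 + ?u powi (- int n) * ?t)"
      using u by (simp add: ln_mult ln_realpow)
    then show "potential n s (a, Fib0) z = bundle_potential (1 + s * real n) (- int n) s z"
      by (simp only: potential.simps bundle_potential_def) (simp add: algebra_simps)
  qed
qed

lemma hsc_values_hirzebruch:
  "hsc_values (hirzebruch n) g = {hol_sect_curv (g c) z \<xi> | c z \<xi>. \<xi> \<noteq> 0}"
proof -
  have "\<exists>P\<in>hirzebruch n. (c, z) \<in> P" for c and z :: "complex^2"
    unfolding hirzebruch_def
    using equiv_class_self[OF equiv_hirzebruch_rel[of n], of "(c, z)"]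
    by (intro bexI[of _ "hirzebruch_rel n `` {(c, z)}"] quotientI) auto
  then show ?thesis unfolding hsc_values_def by blast
qed

text \<open>
  The same formula serves all charts: \<open>y\<close> runs from \<open>0\<close> on the section \<open>z\<^sub>2 = \<infinity>\<close> to \<open>1\<close> on
  the section \<open>z\<^sub>2 = 0\<close>, so it is \<open>1 - Y\<close> in the charts \<open>FibInf\<close> and \<open>Y\<close> in the charts \<open>Fib0\<close>.
\<close>

lemma omega_hsc:
  fixes n :: nat and s :: real and \<xi> :: "complex^2"
  assumes "s > 0" "\<xi> \<noteq> 0"
  obtains y al X V where "0 \<le> y" "y \<le> 1" "al = 1 + s * real n * y" "X \<ge> 0" "V \<ge> 0" "X + V > 0"
    "hol_sect_curv (omega n s c) z \<xi> =
       4 * ((1 / al - s * (real n)\<^sup>2 * y * (1 - y) / al\<^sup>2) * X\<^sup>2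
          + 2 * (s * (real n)\<^sup>2 * y * (1 - y) / al\<^sup>2 - real n * (1 - 2 * y) / al) * X * V
          + V\<^sup>2 / s) / (X + V)\<^sup>2"
proof -
  obtain a f where c: "c = (a, f)" by (cases c)
  have p: "1 + s * real n > 0" using assms(1) by (simp add: add_pos_nonneg)
  show ?thesis
  proof (cases f)
    case FibInf
    have "0 < (1::real)" "0 < 1 + s * of_int (int n)" using p by simp_all
    from bundle_hsc_normalised[OF this assms, of z] obtain Y al X V where *: "0 \<le> Y" "Y \<le> 1"
      "al = 1 + s * of_int (int n) * (1 - Y)" "X \<ge> 0" "V \<ge> 0" "X + V > 0"
      "hol_sect_curv (complex_hessian (bundle_potential 1 (int n) s)) z \<xi> =
       4 * ((1 / al - s * (of_int (int n))\<^sup>2 * Y * (1 - Y) / al\<^sup>2) * X\<^sup>2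
          + 2 * (s * (of_int (int n))\<^sup>2 * Y * (1 - Y) / al\<^sup>2 - of_int (int n) * (2 * Y - 1) / al) * X * V
          + V\<^sup>2 / s) / (X + V)\<^sup>2" by metis
    show ?thesis
      by (rule that[of "1 - Y" al X V])
         (use * in \<open>simp_all add: omega_def c FibInf potential_eq_bundle_potential mult_ac\<close>)
  next
    case Fib0
    have "0 < 1 + s * real n" "0 < 1 + s * real n + s * of_int (- int n)" using p by simp_all
    from bundle_hsc_normalised[OF this assms, of z] obtain Y al X V where *: "0 \<le> Y" "Y \<le> 1"
      "al = 1 + s * real n + s * of_int (- int n) * (1 - Y)" "X \<ge> 0" "V \<ge> 0" "X + V > 0"
      "hol_sect_curv (complex_hessian (bundle_potential (1 + s * real n) (- int n) s)) z \<xi> =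
       4 * ((1 / al - s * (of_int (- int n))\<^sup>2 * Y * (1 - Y) / al\<^sup>2) * X\<^sup>2
          + 2 * (s * (of_int (- int n))\<^sup>2 * Y * (1 - Y) / al\<^sup>2 - of_int (- int n) * (2 * Y - 1) / al) * X * V
          + V\<^sup>2 / s) / (X + V)\<^sup>2" by metis
    have al: "al = 1 + s * real n * Y" using *(3) by (simp add: algebra_simps)
    have k: "(of_int (- int n))\<^sup>2 = (real n)\<^sup>2" "of_int (- int n) * (2 * Y - 1) = real n * (1 - 2 * Y)"
      by (simp_all add: algebra_simps)
    show ?thesis
      by (rule that[of Y al X V])
         (use *(1,2,4-6) *(7)[unfolded k] al in \<open>simp_all add: omega_def c Fib0 potential_eq_bundle_potential\<close>)
  qed
qed

lemma hsc_origin: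
  fixes n :: nat and s :: real and \<xi> :: "complex^2"
  assumes "s > 0" "\<xi> \<noteq> 0"
  defines "X \<equiv> (cmod (\<xi> $ 1))\<^sup>2" and "V \<equiv> s * (cmod (\<xi> $ 2))\<^sup>2"
  shows "hol_sect_curv (omega n s (Base0, FibInf)) 0 \<xi> = 4 * (X\<^sup>2 - 2 * real n * X * V + V\<^sup>2 / s) / (X + V)\<^sup>2"
proof -
  have "0 < (1::real)" "0 < 1 + s * of_int (int n)" using assms(1) by (simp_all add: add_pos_nonneg)
  from bundle_hsc[OF this assms(1), of 0 \<xi>] show ?thesis using assms(1)
    by (simp add: omega_def potential_eq_bundle_potential vertical_def dlog_base_def X_def V_def)
       (simp add: field_simps power2_eq_square power4_eq_xxxx)
qed

section \<open>The optimal pinching constant\<close>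

text \<open>
  For the special \<open>s\<close> the curvature minus the candidate infimum is a quadratic form in \<open>(X, V)\<close>.
  After clearing denominators its coefficients are \<open>P\<close>, \<open>Q\<close>, \<open>R\<close>, and the discriminant
  \<open>P R - Q\<^sup>2\<close> factors with a simple zero at \<open>y = 0\<close> and a cofactor that is positive on the unit
  interval; the form is therefore positive semidefinite and degenerates exactly at the section
  \<open>y = 0\<close>, where the infimum is attained.  The upper bound holds coefficient by coefficient, because
  \<open>X\<close> and \<open>V\<close> are nonnegative.
\<close>

lemma pinching_form_bounds:
  fixes n y X V L s al :: real
  assumes n: "n \<ge> 1" and y: "0 \<le> y" "y \<le> 1" and X: "X \<ge> 0" "V \<ge> 0"
    and L: "L = 2 * n + 1" and s: "s = 1 / (n * L)" and al: "al = 1 + s * n * y"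
  defines "F \<equiv> (1 / al - s * n\<^sup>2 * y * (1 - y) / al\<^sup>2) * X\<^sup>2
          + 2 * (s * n\<^sup>2 * y * (1 - y) / al\<^sup>2 - n * (1 - 2 * y) / al) * X * V + V\<^sup>2 / s"
  shows "n / L * (X + V)\<^sup>2 \<le> F" "F \<le> n * L * (X + V)\<^sup>2"
proof -
  have L0: "L > 0" "n > 0" using n L by auto
  have W: "L + y > 0" using L0 y by simp
  have al': "al = (L + y) / L" using L0 by (simp add: al s field_simps)
  define D where "D = n * L * y * (1 - y) / (L + y)\<^sup>2"
  have D: "s * n\<^sup>2 * y * (1 - y) / al\<^sup>2 = D"
    using L0 W unfolding D_def al' s power_divide by (simp add: power2_eq_square)
  have D0: "D \<ge> 0" using L0 W y by (simp add: D_def)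
  have p: "1 / al - s * n\<^sup>2 * y * (1 - y) / al\<^sup>2 = L / (L + y) - D"
    unfolding D by (simp add: al')
  have q: "s * n\<^sup>2 * y * (1 - y) / al\<^sup>2 - n * (1 - 2 * y) / al = n * L * (y\<^sup>2 + 2 * L * y - L) / (L + y)\<^sup>2"
    unfolding D using L0 W by (simp add: D_def al' divide_simps) (simp add: algebra_simps power2_eq_square)
  have r: "V\<^sup>2 / s = n * L * V\<^sup>2" by (simp add: s)
  have F: "F = (L / (L + y) - D) * X\<^sup>2 + 2 * (n * L * (y\<^sup>2 + 2 * L * y - L) / (L + y)\<^sup>2) * X * V + n * L * V\<^sup>2"
    unfolding F_def p q r ..
  define P where "P = (n + 1) * (4 * n\<^sup>2 * y\<^sup>2 - (4 * n\<^sup>2 - 1) * y + L\<^sup>2)"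
  define Q where "Q = 2 * n * (n + 1) * (2 * n * (L + y)\<^sup>2 - L ^ 3)"
  define R where "R = 4 * n\<^sup>2 * (n + 1) * (L + y)\<^sup>2"
  have R: "R > 0" using L0 W by (simp add: R_def)
  have "L * (L + y)\<^sup>2 * (F - n / L * (X + V)\<^sup>2) = P * X\<^sup>2 + 2 * Q * X * V + R * V\<^sup>2"
  proof -
    have "L * (L + y)\<^sup>2 * (F - n / L * (X + V)\<^sup>2) =
       L * (L * (L + y) - n * L * y * (1 - y)) * X\<^sup>2 + 2 * L * (n * L * (y\<^sup>2 + 2 * L * y - L)) * X * V
       + L * (n * L * (L + y)\<^sup>2) * V\<^sup>2 - n * (L + y)\<^sup>2 * (X + V)\<^sup>2"
      unfolding F D_def using L0 W by (simp add: divide_simps) (simp add: algebra_simps power2_eq_square)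
    also have "\<dots> = P * X\<^sup>2 + 2 * Q * X * V + R * V\<^sup>2"
      unfolding P_def Q_def R_def L by algebra
    finally show ?thesis .
  qed
  moreover have "P * X\<^sup>2 + 2 * Q * X * V + R * V\<^sup>2 \<ge> 0"
  proof -
    have "P * R - Q\<^sup>2 = 4 * n\<^sup>2 * (n + 1)\<^sup>2 * (y * L\<^sup>2 * (3 * L\<^sup>2 - 3 * L * (2 * n - 1) * y - (4 * n - 1) * y\<^sup>2))"
      unfolding P_def Q_def R_def L by algebra
    moreover have "3 * L\<^sup>2 - 3 * L * (2 * n - 1) * y - (4 * n - 1) * y\<^sup>2 \<ge> 0"
    proof -
      have "3 * L * (2 * n - 1) * y \<le> 3 * L * (2 * n - 1)" using n L0 y by (intro mult_left_le) auto
      moreover have "(4 * n - 1) * y\<^sup>2 \<le> 4 * n - 1" using n y by (intro mult_left_le power_le_one) auto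
      moreover have "3 * L\<^sup>2 - 3 * L * (2 * n - 1) = 6 * L" by (simp add: L power2_eq_square algebra_simps)
      ultimately show ?thesis using n L by linarith
    qed
    ultimately have "P * R - Q\<^sup>2 \<ge> 0" using y by simp
    then have "0 \<le> (R * V + Q * X)\<^sup>2 + (P * R - Q\<^sup>2) * X\<^sup>2" by simp
    also have "\<dots> = R * (P * X\<^sup>2 + 2 * Q * X * V + R * V\<^sup>2)" by algebra
    finally show ?thesis using R by (simp add: zero_le_mult_iff)
  qed
  ultimately have "0 \<le> L * (L + y)\<^sup>2 * (F - n / L * (X + V)\<^sup>2)" by simp
  moreover have "L * (L + y)\<^sup>2 > 0" using L0 W by simp
  ultimately have "0 \<le> F - n / L * (X + V)\<^sup>2" by (meson mult_pos_neg not_le)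
  then show "n / L * (X + V)\<^sup>2 \<le> F" by simp
  have nL: "1 \<le> n * L" using mult_mono[of 1 n 1 L] n L by simp
  have "L / (L + y) \<le> 1" using L0 W y by simp
  then have "(L / (L + y) - D) * X\<^sup>2 \<le> n * L * X\<^sup>2" using D0 nL by (intro mult_right_mono) auto
  moreover have "2 * (n * L * (y\<^sup>2 + 2 * L * y - L) / (L + y)\<^sup>2) * X * V \<le> 2 * (n * L) * X * V"
  proof -
    have "y\<^sup>2 + 2 * L * y - L \<le> (L + y)\<^sup>2" using L0 by (simp add: power2_eq_square algebra_simps)
    then have "(y\<^sup>2 + 2 * L * y - L) / (L + y)\<^sup>2 \<le> 1" using W by simp
    then have "n * L * ((y\<^sup>2 + 2 * L * y - L) / (L + y)\<^sup>2) \<le> n * L * 1" using L0 by (intro mult_left_mono) auto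
    then show ?thesis using X by (intro mult_right_mono) auto
  qed
  ultimately show "F \<le> n * L * (X + V)\<^sup>2"
    unfolding F by (simp add: power2_eq_square algebra_simps)
qed

text \<open>
  The first value belongs to the fibre direction.  The second is the minimum of the quadratic form of
  \<open>hsc_origin\<close>, for which \<open>X\<close> and \<open>V\<close> are in the ratio \<open>(1 / s + n) : (1 + n)\<close>, as
  setting the derivative to zero shows.
\<close>

lemma hsc_origin_special:
  fixes n :: nat and s :: real
  assumes "s > 0"
  shows "4 / s \<in> hsc_values (hirzebruch n) (omega n s)"
    and "4 * (1 - s * (real n)\<^sup>2) / (1 + s + 2 * real n * s) \<in> hsc_values (hirzebruch n) (omega n s)"
proof -
  let ?\<xi> = "vector [0, 1] :: complex^2"
  have "hol_sect_curv (omega n s (Base0, FibInf)) 0 ?\<xi> = 4 / s"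
    using hsc_origin[of s ?\<xi> n] assms by (simp add: vec2_eq_iff power2_eq_square)
  then show "4 / s \<in> hsc_values (hirzebruch n) (omega n s)"
    unfolding hsc_values_hirzebruch
    by (intro CollectI exI[of _ "(Base0, FibInf)"] exI[of _ 0] exI[of _ ?\<xi>]) (simp add: vec2_eq_iff)
  define a where "a = 1 / s + real n"
  define b where "b = 1 + real n"
  have ab: "a > 0" "b > 0" using assms by (auto simp: a_def b_def add_pos_nonneg)
  let ?\<eta> = "vector [of_real (sqrt a), of_real (sqrt (b / s))] :: complex^2"
  have nz: "?\<eta> \<noteq> 0" using ab by (simp add: vec2_eq_iff)
  have 1: "(cmod (?\<eta> $ 1))\<^sup>2 = a" "s * (cmod (?\<eta> $ 2))\<^sup>2 = b" using ab assms by simp_all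
  have "hol_sect_curv (omega n s (Base0, FibInf)) 0 ?\<eta> = 4 * (a\<^sup>2 - 2 * real n * a * b + b\<^sup>2 / s) / (a + b)\<^sup>2"
    using hsc_origin[OF assms nz, of n] unfolding 1 .
  also have "a\<^sup>2 - 2 * real n * a * b + b\<^sup>2 / s = (1 / s - (real n)\<^sup>2) * (a + b)"
    unfolding a_def b_def using assms by (simp add: divide_simps) (simp add: algebra_simps power2_eq_square)
  also have "4 * ((1 / s - (real n)\<^sup>2) * (a + b)) / (a + b)\<^sup>2 = 4 * (1 / s - (real n)\<^sup>2) / (a + b)"
    using ab by (simp add: power2_eq_square)
  also have "\<dots> = 4 * (1 - s * (real n)\<^sup>2) / (1 + s + 2 * real n * s)"
  proof -
    have "1 / s - (real n)\<^sup>2 = (1 - s * (real n)\<^sup>2) / s" "a + b = (1 + s + 2 * real n * s) / s"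
      using assms by (simp_all add: a_def b_def field_simps)
    then show ?thesis using assms by simp
  qed
  finally show "4 * (1 - s * (real n)\<^sup>2) / (1 + s + 2 * real n * s) \<in> hsc_values (hirzebruch n) (omega n s)"
    unfolding hsc_values_hirzebruch using nz
    by (intro CollectI exI[of _ "(Base0, FibInf)"] exI[of _ 0] exI[of _ ?\<eta>]) simp
qed

text \<open>
  Two values of the curvature suffice to bound the pinching constant, and the bound they give is
  maximal precisely when the square in the last step vanishes, that is for \<open>s = 1 / (2 n\<^sup>2 + n)\<close>.
\<close>

lemma pinching_le:
  fixes n :: nat and s c :: real
  assumes "s > 0" and pos: "positive_hsc (hirzebruch n) (omega n s)"
    and "pinched_hsc (hirzebruch n) (omega n s) c"
  shows "c \<le> 1 / (1 + 2 * real n)\<^sup>2"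
proof -
  let ?H = "hsc_values (hirzebruch n) (omega n s)"
  let ?m = "4 * (1 - s * (real n)\<^sup>2) / (1 + s + 2 * real n * s)"
  note mem = hsc_origin_special[OF assms(1), of n]
  have bdd: "bdd_below ?H" "bdd_above ?H" and c: "c = Inf ?H / Sup ?H"
    using assms(3) by (auto simp: pinched_hsc_def)
  have inf: "Inf ?H \<le> ?m" using mem(2) bdd(1) by (rule cInf_lower)
  have sup: "4 / s \<le> Sup ?H" using mem(1) bdd(2) by (rule cSup_upper)
  have inf0: "0 \<le> Inf ?H" using pos mem(1) by (intro cInf_greatest) (auto simp: positive_hsc_def intro: less_imp_le)
  have "c \<le> ?m / (4 / s)" unfolding c using inf sup inf0 assms(1) by (intro frac_le) auto
  also have "\<dots> = s * (1 - s * (real n)\<^sup>2) / (1 + s + 2 * real n * s)"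
  proof -
    have "4 * x / d / (4 / s) = s * x / d" for x d by simp
    then show ?thesis .
  qed
  also have "\<dots> \<le> 1 / (1 + 2 * real n)\<^sup>2"
  proof -
    have d: "1 + s + 2 * real n * s > 0" "(1 + 2 * real n)\<^sup>2 > 0"
      using assms(1) by (auto intro!: add_pos_nonneg simp: zero_less_power2)
    have "0 \<le> (1 - real n * (2 * real n + 1) * s)\<^sup>2" by simp
    also have "\<dots> = (1 + s + 2 * real n * s) - s * (1 - s * (real n)\<^sup>2) * (1 + 2 * real n)\<^sup>2" by algebra
    finally show ?thesis using d by (simp add: divide_simps)
  qed
  finally show ?thesis .
qed

lemma hsc_bounds:
  fixes n :: nat
  assumes n: "n \<ge> 1" and K: "K \<in> hsc_values (hirzebruch n) (omega n (1 / (2 * (real n)\<^sup>2 + real n)))"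
  shows "4 * real n / (2 * real n + 1) \<le> K" "K \<le> 4 * (real n * (2 * real n + 1))"
proof -
  define s where "s = 1 / (2 * (real n)\<^sup>2 + real n)"
  have s: "s > 0" using n by (auto simp: s_def intro!: divide_pos_pos add_nonneg_pos)
  have s': "s = 1 / (real n * (2 * real n + 1))" by (simp add: s_def power2_eq_square algebra_simps)
  obtain c z \<xi> where "\<xi> \<noteq> 0" and K: "K = hol_sect_curv (omega n s c) z \<xi>"
    using K unfolding hsc_values_hirzebruch s_def by blast
  then obtain y al X V where *: "0 \<le> y" "y \<le> 1" "al = 1 + s * real n * y" "X \<ge> 0" "V \<ge> 0" "X + V > 0"
    "K = 4 * ((1 / al - s * (real n)\<^sup>2 * y * (1 - y) / al\<^sup>2) * X\<^sup>2
          + 2 * (s * (real n)\<^sup>2 * y * (1 - y) / al\<^sup>2 - real n * (1 - 2 * y) / al) * X * V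
          + V\<^sup>2 / s) / (X + V)\<^sup>2"
    using omega_hsc[OF s, of \<xi> n c z] by metis
  have "real n \<ge> 1" using n by simp
  note b = pinching_form_bounds[OF this *(1,2,4,5) refl s' *(3)]
  have sq: "(X + V)\<^sup>2 > 0" using *(6) by simp
  show "4 * real n / (2 * real n + 1) \<le> K"
    unfolding *(7) using b(1) sq by (subst pos_le_divide_eq) auto
  show "K \<le> 4 * (real n * (2 * real n + 1))"
    unfolding *(7) using b(2) sq by (subst pos_divide_le_eq) auto
qed

theorem mainTheorem3:
  fixes n :: nat
  assumes "n \<ge> 1"
  shows "(\<forall>s c :: real. s > 0 \<longrightarrow> positive_hsc (hirzebruch n) (omega n s)
            \<longrightarrow> pinched_hsc (hirzebruch n) (omega n s) c \<longrightarrow> c \<le> 1 / (1 + 2 * real n)\<^sup>2)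
       \<and> positive_hsc (hirzebruch n) (omega n (1 / (2 * (real n)\<^sup>2 + real n)))
       \<and> pinched_hsc (hirzebruch n) (omega n (1 / (2 * (real n)\<^sup>2 + real n)))
           (1 / (1 + 2 * real n)\<^sup>2)"
proof -
  define s where "s = 1 / (2 * (real n)\<^sup>2 + real n)"
  define L where "L = 2 * real n + 1"
  let ?H = "hsc_values (hirzebruch n) (omega n s)"
  have n: "real n > 0" and L: "L > 0" using assms by (simp_all add: L_def)
  have s: "s = 1 / (real n * L)" by (simp add: s_def L_def power2_eq_square algebra_simps)
  have s0: "s > 0" using n L by (simp add: s)
  note bounds = hsc_bounds[OF assms, folded s_def L_def]
  have max: "4 * (real n * L) \<in> ?H" using hsc_origin_special(1)[OF s0, of n] by (simp add: s)
  have "4 * (1 - s * (real n)\<^sup>2) / (1 + s + 2 * real n * s) = 4 * real n / L"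
  proof -
    have 1: "1 - s * (real n)\<^sup>2 = (real n + 1) / L"
    proof -
      have "s * (real n)\<^sup>2 = real n / L" unfolding s using n by (simp add: power2_eq_square)
      then show ?thesis using L by (simp add: diff_divide_eq_iff) (simp add: L_def)
    qed
    have 2: "1 + s + 2 * real n * s = (real n + 1) / real n"
    proof -
      have "1 + s + 2 * real n * s = 1 + L * s" by (simp add: L_def algebra_simps)
      also have "L * s = 1 / real n" unfolding s using L by simp
      also have "1 + 1 / real n = (real n + 1) / real n" using n by (simp add: field_simps)
      finally show ?thesis .
    qed
    have cancel: "4 * (x / L) / (x / real n) = 4 * real n / L" if "x > 0" for x
      using that by simp
    show ?thesis unfolding 1 2 by (rule cancel) (use n in simp)
  qed
  then have min: "4 * real n / L \<in> ?H" using hsc_origin_special(2)[OF s0, of n] by simp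
  have inf: "Inf ?H = 4 * real n / L" using min bounds(1) by (rule cInf_eq_minimum)
  have sup: "Sup ?H = 4 * (real n * L)" using max bounds(2) by (rule cSup_eq_maximum)
  have "positive_hsc (hirzebruch n) (omega n s)"
    unfolding positive_hsc_def
  proof
    fix K assume "K \<in> ?H"
    from bounds(1)[OF this] show "0 < K" using n L by (meson divide_pos_pos less_le_trans mult_pos_pos zero_less_numeral)
  qed
  moreover have "pinched_hsc (hirzebruch n) (omega n s) (1 / (1 + 2 * real n)\<^sup>2)"
    unfolding pinched_hsc_def
  proof (intro conjI)
    have L2: "(1 + 2 * real n)\<^sup>2 = L\<^sup>2" by (simp add: L_def add.commute)
    show "0 < 1 / (1 + 2 * real n)\<^sup>2" unfolding L2 using L by simp
    show "1 / (1 + 2 * real n)\<^sup>2 \<le> 1" by (simp add: one_le_power)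
    show "bdd_below ?H" using bounds(1) by (rule bdd_belowI)
    show "bdd_above ?H" using bounds(2) by (rule bdd_aboveI)
    show "Inf ?H / Sup ?H = 1 / (1 + 2 * real n)\<^sup>2"
      unfolding inf sup L2 using n L by (simp add: power2_eq_square)
  qed
  ultimately show ?thesis using pinching_le unfolding s_def by blast
qed

end
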